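(* Let $F:\mathbb{R}^N\times\mathbb{R}\times\mathbb{R}^N\times\mathbb{S}^N\to\mathbb{R}$ and $g:\mathbb{R}^N\to\mathbb{R}$ satisfy (C1), (C2) and (C3), and let $u$ and $v_\varepsilon$ be (weak) solutions of $$\min\{F(x,u,Du,D^2u),\,u-g\}=0\quad\text{in }\mathbb{R}^N,\qquad F(x,v_\varepsilon,Dv_\varepsilon,D^2v_\varepsilon)=\frac1\varepsilon (v_\varepsilon-g)^-\quad\text{in }\mathbb{R}^N,$$ respectively. If $|D^2g^-|_0<\infty$ (case (i) of (C3)), then $$0\le u-v_\varepsilon\le C\varepsilon\quad\text{in }\mathbb{R}^N .$$ Otherwise ($g\in C^{0,\mu}(\mathbb{R}^N)$, cases (ii) and (iii) of (C3), with $\mu=1$ in case (ii)), $$0\le u-v_\varepsilon\le C\varepsilon^{\mu/2}\quad\text{in }\mathbb{R}^N .$$ The constants $C$ depend only on $g$ and on $C_R$ from (C3).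
   Context: $\mathbb{S}^N$ is the space of real symmetric $N\times N$ matrices, with $X\ge Y$ meaning $X-Y$ positive semidefinite; $s^-=-\min(s,0)$ for real $s$, and $X^-$ is the negative part of a symmetric matrix $X$. $|f|_0=\sup|f|$, $[f]_\mu=\sup_{x\ne y}|f(x)-f(y)|/|x-y|^\mu$, $|f|_\mu=|f|_0+[f]_\mu$, $C^{0,\mu}(\mathbb{R}^N)=\{|f|_\mu<\infty\}$ for $\mu\in(0,1]$, and $|f|_{0,1}:=|f|_1$. For $\phi\in C^2$, $|D^2\phi^-|_0=\sup_x|(D^2\phi(x))^-|$; for non-smooth $g$, $|D^2g^-|_0<\infty$ is understood as $D^2g\ge -C\,I$ in the sense of distributions for some constant $C$. The parameter $\varepsilon>0$ is the penalization parameter. No particular form of $F$ is assumed. Two equations are considered: the obstacle problem (E) $\min\{F(x,u,Du,D^2u),u-g\}=0$ in $\mathbb{R}^N$, and the penalized problem (PE) $F(x,v,Dv,D^2v)=\frac1\varepsilon(v-g)^-$ in $\mathbb{R}^N$. Weak solutions: a notion of weak sub-/supersolution is fixed, together with a class of admissible functions ("boundary condition at infinity", e.g. bounded functions or functions of linear growth). Viscosity solutions are the weakest notion allowed. A solution is a function that is both a sub- and a supersolution. The class contains all bounded $C^2$ functions and is stable under adding constants; bounded $C^2$ functions satisfying the inequality pointwise are weak sub-/supersolutions; and pointwise arguments are legitimate: if $w$ is a weak supersolution of $G(x,w,Dw,D^2w)=0$, $c$ is a constant, and $G(x,w(x),p,X)\ge0$ implies $H(x,w(x)+c,p,X)\ge0$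 for all $x,p,X$, then $w+c$ is a weak supersolution of $H=0$ (similarly for subsolutions with reversed inequalities). (C1) (Comparison) The equations (E) and (PE) satisfy the comparison principle for the class of weak solutions under consideration: if $w_1$ is a subsolution and $w_2$ a supersolution in the class, then $w_1\le w_2$ in $\mathbb{R}^N$. (C2) (Monotonicity) If $X,Y\in\mathbb{S}^N$, $p,x\in\mathbb{R}^N$, $r,s\in\mathbb{R}$, $X\ge Y$ and $r\le s$, then $F(x,r,p,X)\le F(x,s,p,Y)$. (C3) (Regularity) One of the following holds, with constants $C_R$ depending on $R$: (i) $g\in C^{0,1}(\mathbb{R}^N)$, $|D^2g^-|_0\le C$ for some constant $C$, and for every $x\in\mathbb{R}^N$ and $\phi\in C^2(\mathbb{R}^N)$ with $|\phi|_{0,1}+|D^2\phi^-|_0\le R$: $F(x,\phi(x),D\phi(x),D^2\phi(x))\le C_R$. (ii) $g\in C^{0,1}(\mathbb{R}^N)$, and for every $x\in\mathbb{R}^N$ and $\phi\in C^2(\mathbb{R}^N)$ with $|\phi|_{0,1}\le R$: $F(x,\phi(x),D\phi(x),D^2\phi(x))\le C_R(1+|D^2\phi^-|_0)$. (iii) $g\in C^{0,\mu}(\mathbb{R}^N)$ for some $\mu\in(0,1)$, and for every $x\in\mathbb{R}^N$ and $\phi\in C^2(\mathbb{R}^N)$ with $|\phi|_0\le R$: $F(x,\phi(x),D\phi(x),D^2\phi(x))\le C_R(1+|D\phi|_0+|D^2\phi^-|_0)$.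
   Formalization: In cases (ii) and (iii) the constant C is uniform only for ε in (0, ε_max], with ε_max > 0 arbitrary and C depending also on it; for F ≡ 1 one has u − v_ε = ε, so no C serves all ε > 0. *)

theory Defs
  imports "HOL-Analysis.Analysis"
begin

section \<open>Symmetric matrices\<close>

definition sym_mat :: "real^'n^'n \<Rightarrow> bool" where
  "sym_mat X \<longleftrightarrow> transpose X = X"

definition psd :: "real^'n^'n \<Rightarrow> bool" where
  "psd X \<longleftrightarrow> sym_mat X \<and> (\<forall>\<xi>. 0 \<le> \<xi> \<bullet> (X *v \<xi>))"

definition neg_part :: "real \<Rightarrow> real" where
  "neg_part s = - min s 0"

text \<open>The negative part of a symmetric matrix \<open>X\<close> is the matrix \<open>Y\<close> in the unique decomposition
  \<open>X = P - Y\<close> into positive semidefinite matrices with \<open>P Y = 0\<close>.  The value is unspecified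
  if \<open>X\<close> is not symmetric.\<close>

definition mat_neg_part :: "real^'n^'n \<Rightarrow> real^'n^'n" where
  "mat_neg_part X = (THE Y. psd Y \<and> (\<exists>P. psd P \<and> X = P - Y \<and> P ** Y = 0))"

section \<open>Functions of class \<open>C\<^sup>k\<close>, gradient and Hessian\<close>

definition partial :: "'n \<Rightarrow> (real^'n \<Rightarrow> real) \<Rightarrow> real^'n \<Rightarrow> real" where
  "partial i f x = frechet_derivative f (at x) (axis i 1)"

definition grad :: "(real^'n \<Rightarrow> real) \<Rightarrow> real^'n \<Rightarrow> real^'n" where
  "grad f x = (\<chi> i. partial i f x)"

definition hess :: "(real^'n \<Rightarrow> real) \<Rightarrow> real^'n \<Rightarrow> real^'n^'n" where
  "hess f x = (\<chi> i j. partial j (partial i f) x)"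

primrec Ck :: "nat \<Rightarrow> (real^'n \<Rightarrow> real) \<Rightarrow> bool" where
  "Ck 0 f \<longleftrightarrow> continuous_on UNIV f"
| "Ck (Suc k) f \<longleftrightarrow> f differentiable_on UNIV \<and> (\<forall>i. Ck k (partial i f))"

definition test_function :: "(real^'n \<Rightarrow> real) \<Rightarrow> bool" where
  "test_function \<eta> \<longleftrightarrow> (\<forall>k. Ck k \<eta>) \<and> compact (closure {x. \<eta> x \<noteq> 0})"

section \<open>Norms\<close>

text \<open>Sup norms and seminorms take values in \<open>ereal\<close>, so that they are \<open>\<infinity>\<close> for unbounded
  functions.  For matrix-valued functions, \<open>norm\<close> is the Frobenius norm.\<close>

definition sup_norm :: "(real^'n \<Rightarrow> 'b::real_normed_vector) \<Rightarrow> ereal" where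
  "sup_norm f = (SUP x. ereal (norm (f x)))"

definition holder_seminorm :: "real \<Rightarrow> (real^'n \<Rightarrow> real) \<Rightarrow> ereal" where
  "holder_seminorm \<mu> f = (SUP x. SUP y\<in>-{x}. ereal (\<bar>f x - f y\<bar> / norm (x - y) powr \<mu>))"

definition holder_norm :: "real \<Rightarrow> (real^'n \<Rightarrow> real) \<Rightarrow> ereal" where
  "holder_norm \<mu> f = sup_norm f + holder_seminorm \<mu> f"

definition holder_space :: "real \<Rightarrow> (real^'n \<Rightarrow> real) set" where
  "holder_space \<mu> = {f. holder_norm \<mu> f < \<infinity>}"

text \<open>\<open>D\<^sup>2g \<ge> -K I\<close> in the sense of distributions, tested in every direction \<open>\<xi>\<close>.\<close>

definition hess_ge_distr :: "(real^'n \<Rightarrow> real) \<Rightarrow> real \<Rightarrow> bool" where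
  "hess_ge_distr g K \<longleftrightarrow>
     (\<forall>\<eta> \<xi>. test_function \<eta> \<and> (\<forall>x. 0 \<le> \<eta> x) \<longrightarrow>
        (\<integral>x. g x * (\<xi> \<bullet> (hess \<eta> x *v \<xi>)) \<partial>lborel)
          \<ge> - K * (\<xi> \<bullet> \<xi>) * (\<integral>x. \<eta> x \<partial>lborel))"

section \<open>Equations\<close>

text \<open>An operator \<open>G\<close> stands for the equation \<open>G(x, w, Dw, D\<^sup>2w) = 0\<close>.  Its last argument is meant
  to be a symmetric matrix; values at non-symmetric matrices are irrelevant.\<close>

type_synonym 'n operator = "real^'n \<Rightarrow> real \<Rightarrow> real^'n \<Rightarrow> real^'n^'n \<Rightarrow> real"

definition obstacle_op :: "'n::finite operator \<Rightarrow> (real^'n \<Rightarrow> real) \<Rightarrow> 'n::finite operator" where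
  "obstacle_op F g = (\<lambda>x r p X. min (F x r p X) (r - g x))"

definition penalized_op ::
    "'n::finite operator \<Rightarrow> (real^'n \<Rightarrow> real) \<Rightarrow> real \<Rightarrow> 'n::finite operator" where
  "penalized_op F g \<epsilon> = (\<lambda>x r p X. F x r p X - 1 / \<epsilon> * neg_part (r - g x))"

definition proper :: "'n::finite operator \<Rightarrow> bool" where
  "proper G \<longleftrightarrow> (\<forall>x p r s X Y. sym_mat X \<and> sym_mat Y \<and> psd (X - Y) \<and> r \<le> s
      \<longrightarrow> G x r p X \<le> G x s p Y)"

section \<open>Weak solutions\<close>

definition local_max_at :: "(real^'n \<Rightarrow> real) \<Rightarrow> real^'n \<Rightarrow> bool" where
  "local_max_at f x \<longleftrightarrow> (\<forall>\<^sub>F y in nhds x. f y \<le> f x)"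

definition local_min_at :: "(real^'n \<Rightarrow> real) \<Rightarrow> real^'n \<Rightarrow> bool" where
  "local_min_at f x \<longleftrightarrow> (\<forall>\<^sub>F y in nhds x. f x \<le> f y)"

definition viscosity_subsol :: "'n::finite operator \<Rightarrow> (real^'n \<Rightarrow> real) \<Rightarrow> bool" where
  "viscosity_subsol G w \<longleftrightarrow>
     (\<forall>a. open {x. w x < a}) \<and>
     (\<forall>\<phi> x. Ck 2 \<phi> \<and> local_max_at (\<lambda>y. w y - \<phi> y) x \<longrightarrow> G x (w x) (grad \<phi> x) (hess \<phi> x) \<le> 0)"

definition viscosity_supersol :: "'n::finite operator \<Rightarrow> (real^'n \<Rightarrow> real) \<Rightarrow> bool" where
  "viscosity_supersol G w \<longleftrightarrow>
     (\<forall>a. open {x. w x > a}) \<and>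
     (\<forall>\<phi> x. Ck 2 \<phi> \<and> local_min_at (\<lambda>y. w y - \<phi> y) x \<longrightarrow> G x (w x) (grad \<phi> x) (hess \<phi> x) \<ge> 0)"

text \<open>An abstract notion of weak sub- and supersolution of proper equations, with a class \<open>adm\<close> of
  admissible functions encoding the boundary condition at infinity.  Properness is needed for
  consistency: for an operator that is not degenerate elliptic, a classical subsolution need
  not be a viscosity subsolution.\<close>

locale weak_solution_notion =
  fixes subsol supersol :: "'n::finite operator \<Rightarrow> (real^'n \<Rightarrow> real) \<Rightarrow> bool"
    and adm :: "(real^'n \<Rightarrow> real) set"
  assumes subsol_viscosity:
      "proper G \<Longrightarrow> subsol G w \<Longrightarrow> viscosity_subsol G w"
    and supersol_viscosity:
      "proper G \<Longrightarrow> supersol G w \<Longrightarrow> viscosity_supersol G w"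
    and adm_C2: "Ck 2 w \<Longrightarrow> bounded (range w) \<Longrightarrow> w \<in> adm"
    and adm_add_const: "w \<in> adm \<Longrightarrow> (\<lambda>x. w x + c) \<in> adm"
    and subsol_classical:
      "proper G \<Longrightarrow> Ck 2 w \<Longrightarrow> bounded (range w) \<Longrightarrow>
       (\<And>x. G x (w x) (grad w x) (hess w x) \<le> 0) \<Longrightarrow> subsol G w"
    and supersol_classical:
      "proper G \<Longrightarrow> Ck 2 w \<Longrightarrow> bounded (range w) \<Longrightarrow>
       (\<And>x. G x (w x) (grad w x) (hess w x) \<ge> 0) \<Longrightarrow> supersol G w"
    and subsol_shift:
      "proper G \<Longrightarrow> proper H \<Longrightarrow> subsol G w \<Longrightarrow>
       (\<And>x p X. sym_mat X \<Longrightarrow> G x (w x) p X \<le> 0 \<Longrightarrow> H x (w x + c) p X \<le> 0) \<Longrightarrow>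
       subsol H (\<lambda>x. w x + c)"
    and supersol_shift:
      "proper G \<Longrightarrow> proper H \<Longrightarrow> supersol G w \<Longrightarrow>
       (\<And>x p X. sym_mat X \<Longrightarrow> G x (w x) p X \<ge> 0 \<Longrightarrow> H x (w x + c) p X \<ge> 0) \<Longrightarrow>
       supersol H (\<lambda>x. w x + c)"

definition weak_solution ::
    "('n::finite operator \<Rightarrow> (real^'n \<Rightarrow> real) \<Rightarrow> bool) \<Rightarrow> ('n::finite operator \<Rightarrow> (real^'n \<Rightarrow> real) \<Rightarrow> bool) \<Rightarrow>
     (real^'n \<Rightarrow> real) set \<Rightarrow> 'n::finite operator \<Rightarrow> (real^'n \<Rightarrow> real) \<Rightarrow> bool" where
  "weak_solution subsol supersol adm G w \<longleftrightarrow> w \<in> adm \<and> subsol G w \<and> supersol G w"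

definition comparison ::
    "('n::finite operator \<Rightarrow> (real^'n \<Rightarrow> real) \<Rightarrow> bool) \<Rightarrow> ('n::finite operator \<Rightarrow> (real^'n \<Rightarrow> real) \<Rightarrow> bool) \<Rightarrow>
     (real^'n \<Rightarrow> real) set \<Rightarrow> 'n::finite operator \<Rightarrow> bool" where
  "comparison subsol supersol adm G \<longleftrightarrow>
     (\<forall>w1\<in>adm. \<forall>w2\<in>adm. subsol G w1 \<and> supersol G w2 \<longrightarrow> (\<forall>x. w1 x \<le> w2 x))"

section \<open>Comparison and regularity assumptions\<close>

definition comparison_assm where
  "comparison_assm subsol supersol adm F g \<epsilon> \<longleftrightarrow>
     comparison subsol supersol adm (obstacle_op F g) \<and>
     comparison subsol supersol adm (penalized_op F g \<epsilon>)"

text \<open>The function \<open>CR\<close> gives the constants \<open>C\<^sub>R\<close>.  In the second and third condition the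
  bound is void when a norm on its right-hand side is infinite; this is made explicit because
  \<open>0 * \<infinity> = 0\<close> in \<open>ereal\<close> and the sign of \<open>C\<^sub>R\<close> is not prescribed.\<close>

definition regular_semiconvex :: "'n::finite operator \<Rightarrow> (real^'n \<Rightarrow> real) \<Rightarrow> (real \<Rightarrow> real) \<Rightarrow> bool" where
  "regular_semiconvex F g CR \<longleftrightarrow> g \<in> holder_space 1 \<and> (\<exists>K. hess_ge_distr g K) \<and>
     (\<forall>R x \<phi>. Ck 2 \<phi> \<and>
        holder_norm 1 \<phi> + sup_norm (\<lambda>y. mat_neg_part (hess \<phi> y)) \<le> ereal R \<longrightarrow>
        F x (\<phi> x) (grad \<phi> x) (hess \<phi> x) \<le> CR R)"

definition regular_lipschitz :: "'n::finite operator \<Rightarrow> (real^'n \<Rightarrow> real) \<Rightarrow> (real \<Rightarrow> real) \<Rightarrow> bool" where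
  "regular_lipschitz F g CR \<longleftrightarrow> g \<in> holder_space 1 \<and>
     (\<forall>R x \<phi>. Ck 2 \<phi> \<and> holder_norm 1 \<phi> \<le> ereal R \<and>
        sup_norm (\<lambda>y. mat_neg_part (hess \<phi> y)) < \<infinity> \<longrightarrow>
        ereal (F x (\<phi> x) (grad \<phi> x) (hess \<phi> x))
          \<le> ereal (CR R) * (1 + sup_norm (\<lambda>y. mat_neg_part (hess \<phi> y))))"

definition regular_holder ::
    "real \<Rightarrow> 'n::finite operator \<Rightarrow> (real^'n \<Rightarrow> real) \<Rightarrow> (real \<Rightarrow> real) \<Rightarrow> bool" where
  "regular_holder \<mu> F g CR \<longleftrightarrow> 0 < \<mu> \<and> \<mu> < 1 \<and> g \<in> holder_space \<mu> \<and>
     (\<forall>R x \<phi>. Ck 2 \<phi> \<and> sup_norm \<phi> \<le> ereal R \<and>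
        sup_norm (grad \<phi>) < \<infinity> \<and> sup_norm (\<lambda>y. mat_neg_part (hess \<phi> y)) < \<infinity> \<longrightarrow>
        ereal (F x (\<phi> x) (grad \<phi> x) (hess \<phi> x))
          \<le> ereal (CR R) * (1 + sup_norm (grad \<phi>) + sup_norm (\<lambda>y. mat_neg_part (hess \<phi> y))))"

end

theory Submission
  imports Defs
begin

text \<open>
  Since \<open>u\<close> is a supersolution of the penalized equation, \<open>v \<le> u\<close> by comparison.  For the upper
  bound let \<open>\<phi>\<close> be a mollification of \<open>g\<close> with \<open>|\<phi> - g| \<le> \<eta>\<close> and
  \<open>F(x, \<phi>, D\<phi>, D\<^sup>2\<phi>) \<le> M\<close>.  Then \<open>\<phi> - \<eta> - \<epsilon>M\<close> is a classical subsolution of the penalized equation,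
  so \<open>v \<ge> g - 2\<eta> - \<epsilon>M\<close>; hence \<open>v + 2\<eta> + \<epsilon>M\<close> is a supersolution of the obstacle problem and
  dominates \<open>u\<close>.  If \<open>D\<^sup>2g\<close> is bounded below, \<open>M\<close> is uniform in the mollification and \<open>\<eta> \<rightarrow> 0\<close>;
  otherwise \<open>M\<close> grows like \<open>\<delta>\<^bsup>\<mu>-2\<^esup>\<close> with the mollification scale \<open>\<delta>\<close>, while \<open>\<eta>\<close> is of order \<open>\<delta>\<^sup>\<mu>\<close>.
\<close>

section \<open>The negative part of a symmetric matrix\<close>

text \<open>Since \<open>F\<close> is nonincreasing in its matrix argument, the regularity
  conditions involve the Hessian only through its negative part. That part is given by a description
  operator, so the splitting must first be shown to exist and to be unique: existence comes from
  projecting onto the cone of positive semidefinite matrices, uniqueness from the self-duality of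
  that cone. Mollification takes place at unit scale: \<open>g (\<delta> *\<^sub>R y)\<close> is
  averaged against a fixed kernel and the result is evaluated at
  \<open>(1 / \<delta>) *\<^sub>R x\<close>. The kernel constants are then free of \<delta>, and
  each derivative costs exactly one factor \<open>1 / \<delta>\<close>. The distributional bound is
  tested against functions of class \<open>Ck k\<close> for all \<open>k\<close>, so the kernel has
  to be smooth of every order. The final constants may depend neither on \<open>F\<close> nor on the
  notion of solution nor on \<epsilon>, so each is fixed before these are introduced. Without a
  lower bound on the Hessian, \<open>\<epsilon> * M\<close> contains terms of order \<epsilon> and
  \<open>\<epsilon> powr ((\<mu> + 1) / 2)\<close>, which \<open>\<epsilon> powr (\<mu> / 2)\<close>
  dominates only on bounded ranges; this is the origin of \<open>\<epsilon>max\<close>.\<close>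

lemma matrix_add_rdistrib:
  fixes A B C :: "real^'n^'n"
  shows "(A + B) ** C = A ** C + B ** C"
  by (simp add: matrix_matrix_mult_def vec_eq_iff sum.distrib distrib_right)

text \<open>The inner product on \<open>real^'n^'n\<close> is the Frobenius product, for which left
  multiplication by \<open>A\<close> has adjoint left multiplication by
  \<open>transpose A\<close>.\<close>

lemma inner_matrix_mult_left:
  fixes A B C :: "real^'n^'n"
  shows "inner (A ** B) C = inner B (transpose A ** C)"
proof -
  have "inner (A ** B) C = (\<Sum>i\<in>UNIV. \<Sum>j\<in>UNIV. \<Sum>k\<in>UNIV. A$i$k * B$k$j * C$i$j)"
    by (simp add: inner_vec_def matrix_matrix_mult_def sum_distrib_right)
  also have "\<dots> = (\<Sum>i\<in>UNIV. \<Sum>k\<in>UNIV. \<Sum>j\<in>UNIV. A$i$k * B$k$j * C$i$j)"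
    by (rule sum.cong[OF refl], rule sum.swap)
  also have "\<dots> = (\<Sum>k\<in>UNIV. \<Sum>i\<in>UNIV. \<Sum>j\<in>UNIV. A$i$k * B$k$j * C$i$j)"
    by (rule sum.swap)
  also have "\<dots> = (\<Sum>k\<in>UNIV. \<Sum>j\<in>UNIV. \<Sum>i\<in>UNIV. A$i$k * B$k$j * C$i$j)"
    by (rule sum.cong[OF refl], rule sum.swap)
  also have "\<dots> = inner B (transpose A ** C)"
    by (simp add: inner_vec_def matrix_matrix_mult_def transpose_def sum_distrib_left mult_ac)
  finally show ?thesis .
qed

lemma inner_transpose:
  fixes A B :: "real^'n^'n"
  shows "inner (transpose A) (transpose B) = inner A B"
  unfolding inner_vec_def transpose_def by simp (rule sum.swap)

lemma inner_matrix_mult_right: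
  fixes A B C :: "real^'n^'n"
  shows "inner (A ** B) C = inner A (C ** transpose B)"
  using inner_matrix_mult_left[of "transpose B" "transpose A" "transpose C"]
  by (metis inner_transpose matrix_transpose_mul transpose_transpose)

text \<open>Pairing with this rank-one matrix evaluates the quadratic form at \<xi>.
  Semidefiniteness thus becomes a family of linear inequalities in the matrix, which makes the cone
  visibly closed and convex.\<close>

definition outer_square :: "real^'n \<Rightarrow> real^'n^'n" where
  "outer_square \<xi> = (\<chi> i j. \<xi>$i * \<xi>$j)"

lemma inner_outer_square: "inner X (outer_square \<xi>) = \<xi> \<bullet> (X *v \<xi>)"
  by (simp add: inner_vec_def outer_square_def matrix_vector_mult_def sum_distrib_left mult_ac)

lemma psd_outer_square: "psd (outer_square \<xi>)"
proof -
  have "\<zeta> \<bullet> (outer_square \<xi> *v \<zeta>) = (\<zeta> \<bullet> \<xi>)\<^sup>2" for \<zeta>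
    by (simp add: inner_vec_def outer_square_def matrix_vector_mult_def sum_distrib_left
        sum_distrib_right power2_eq_square mult_ac sum_product)
  then show ?thesis
    by (simp add: psd_def sym_mat_def outer_square_def transpose_def vec_eq_iff mult.commute)
qed

lemma psd_iff_inner: "psd X \<longleftrightarrow> sym_mat X \<and> (\<forall>\<xi>. 0 \<le> inner X (outer_square \<xi>))"
  by (simp add: psd_def inner_outer_square)

section \<open>The cone of positive semidefinite matrices\<close>

lemma sym_mat_iff: "sym_mat X \<longleftrightarrow> (\<forall>i j. X$i$j = X$j$i)"
  unfolding sym_mat_def transpose_def vec_eq_iff by auto

lemma sym_mat_add: "sym_mat X \<Longrightarrow> sym_mat Y \<Longrightarrow> sym_mat (X + Y)"
  and sym_mat_diff: "sym_mat X \<Longrightarrow> sym_mat Y \<Longrightarrow> sym_mat (X - Y)"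
  and sym_mat_minus: "sym_mat X \<Longrightarrow> sym_mat (- X)"
  and sym_mat_scaleR: "sym_mat X \<Longrightarrow> sym_mat (c *\<^sub>R X)"
  by (simp_all add: sym_mat_iff)

lemma psd_0: "psd 0"
  by (simp add: psd_iff_inner sym_mat_iff)

lemma psd_mat_1: "psd (mat 1)"
  by (simp add: psd_def sym_mat_def)

lemma psd_add: "psd X \<Longrightarrow> psd Y \<Longrightarrow> psd (X + Y)"
  by (simp add: psd_iff_inner sym_mat_add inner_add_left)

lemma psd_scaleR: "psd X \<Longrightarrow> 0 \<le> c \<Longrightarrow> psd (c *\<^sub>R X)"
  by (simp add: psd_iff_inner sym_mat_scaleR)

lemma psd_congruence:
  assumes "psd P" shows "psd (B ** P ** transpose B)"
proof -
  have "\<xi> \<bullet> ((B ** P ** transpose B) *v \<xi>) = (transpose B *v \<xi>) \<bullet> (P *v (transpose B *v \<xi>))" for \<xi>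
    by (simp add: matrix_vector_mul_assoc[symmetric] dot_lmul_matrix)
  then show ?thesis
    using assms by (simp add: psd_def sym_mat_def matrix_transpose_mul matrix_mul_assoc
        del: transpose_matrix_vector)
qed

lemma convex_psd: "convex {X :: real^'n^'n. psd X}"
  by (rule convexI) (auto intro: psd_add psd_scaleR)

lemma closed_psd: "closed {X :: real^'n^'n. psd X}"
proof -
  have "{X :: real^'n^'n. psd X} =
      (\<Inter>i. \<Inter>j. {X. X$i$j = X$j$i}) \<inter> (\<Inter>\<xi>. {X. 0 \<le> inner X (outer_square \<xi>)})"
    by (auto simp: psd_iff_inner sym_mat_iff)
  also have "closed \<dots>"
    by (intro closed_Int closed_INT ballI closed_Collect_eq closed_Collect_le continuous_intros)
  finally show ?thesis .
qed

lemma linear_quadratic_nonneg_imp_0: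
  fixes m q :: real
  assumes "\<And>t. 0 \<le> t * m + t\<^sup>2 * q"
  shows "m = 0"
proof (rule ccontr)
  assume "m \<noteq> 0"
  \<comment> \<open>At \<open>t = - m / a\<close> the linear term is \<open>- m\<^sup>2 / a\<close>,
    and the quadratic term cannot compensate for it because \<open>q < a\<close>.\<close>
  define a where "a = \<bar>q\<bar> + 1"
  have a: "a > 0" "q < a" by (auto simp: a_def)
  have "(- m / a) * m + (- m / a)\<^sup>2 * q = m\<^sup>2 / a\<^sup>2 * (q - a)"
    using a by (simp add: field_simps power2_eq_square)
  also have "\<dots> < 0"
    using a \<open>m \<noteq> 0\<close> by (intro mult_pos_neg) auto
  finally show False using assms[of "- m / a"] by simp
qed

text \<open>The Moreau decomposition of \<open>X\<close> with respect to the cone of positive semidefinite matrices.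
  Differentiating \<open>Y \<bullet> (1 + tA) P (1 + tA)\<^sup>T \<ge> 0\<close> at \<open>t = 0\<close> turns orthogonality into \<open>P Y = 0\<close>.\<close>

lemma psd_moreau:
  fixes X :: "real^'n^'n"
  assumes "sym_mat X"
  obtains P Y where "psd P" "psd Y" "X = P - Y" "P ** Y = 0"
    "\<And>Z. psd Z \<Longrightarrow> 0 \<le> inner Y Z"
proof -
  define S where "S = {X :: real^'n^'n. psd X}"
  define P where "P = closest_point S X"
  define Y where "Y = P - X"
  have S: "closed S" "convex S" "S \<noteq> {}"
    using psd_0 by (auto simp: S_def closed_psd convex_psd)
  have P: "psd P"
    using closest_point_in_set[OF S(1,3)] by (auto simp: P_def S_def)
  have dot: "0 \<le> inner Y (Z - P)" if "psd Z" for Z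
    using closest_point_dot[OF S(2,1), of Z X] that
    unfolding P_def[symmetric] Y_def by (simp add: S_def inner_diff_left inner_diff_right)
  \<comment> \<open>\<open>P\<close> lies on a ray of the cone; moving along it in both directions,
    to \<open>0\<close> and to \<open>2 *\<^sub>R P\<close>, squeezes \<open>inner Y P\<close> to
    zero.\<close>
  have "0 \<le> inner Y (0 - P)" by (rule dot[OF psd_0])
  moreover have "0 \<le> inner Y (2 *\<^sub>R P - P)" by (rule dot) (simp add: P psd_scaleR)
  ultimately have YP: "inner Y P = 0" by (simp add: inner_diff_right)
  have dual: "0 \<le> inner Y Z" if "psd Z" for Z
    using dot[OF that] YP by (simp add: inner_diff_right)
  have symP: "transpose P = P" using P by (simp add: psd_def sym_mat_def)
  have symY: "sym_mat Y" using P assms by (simp add: Y_def psd_def sym_mat_diff)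
  have psdY: "psd Y" using symY dual psd_outer_square by (auto simp: psd_iff_inner)
  have tY: "transpose Y = Y" using symY by (simp add: sym_mat_def)
  \<comment> \<open>With this direction the linear coefficient in \<open>t\<close> is twice the
    squared norm of \<open>Y ** P\<close>, while the constant term is
    \<open>inner Y P = 0\<close>.\<close>
  define A where "A = Y ** P"
  have "inner Y (A ** P) + inner Y (P ** transpose A) = 0"
  proof (rule linear_quadratic_nonneg_imp_0)
    fix t :: real
    have "(mat 1 + t *\<^sub>R A) ** P ** transpose (mat 1 + t *\<^sub>R A)
      = P + t *\<^sub>R (A ** P + P ** transpose A) + t\<^sup>2 *\<^sub>R (A ** P ** transpose A)"
    proof -
      have tr: "transpose (mat 1 + t *\<^sub>R A) = mat 1 + t *\<^sub>R transpose A"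
        by (simp add: vec_eq_iff transpose_def mat_def)
      show ?thesis unfolding tr
        by (simp add: matrix_add_rdistrib matrix_add_ldistrib scalar_matrix_assoc[symmetric]
            matrix_scalar_ac power2_eq_square algebra_simps flip: matrix_mul_assoc)
    qed
    moreover have "0 \<le> inner Y ((mat 1 + t *\<^sub>R A) ** P ** transpose (mat 1 + t *\<^sub>R A))"
      by (intro dual psd_congruence P)
    ultimately show "0 \<le> t * (inner Y (A ** P) + inner Y (P ** transpose A))
        + t\<^sup>2 * inner Y (A ** P ** transpose A)"
      by (simp add: inner_add_right YP)
  qed
  moreover have "inner Y (P ** transpose A) = inner Y (A ** P)"
    using inner_transpose[of Y "A ** P"] by (simp add: matrix_transpose_mul symP tY)
  moreover have "inner Y (A ** P) = inner A A"
    using inner_matrix_mult_right[of A P Y] by (simp add: symP A_def inner_commute)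
  ultimately have "Y ** P = 0" by (simp add: A_def)
  then have "P ** Y = 0"
    by (metis matrix_transpose_mul symP tY transpose_transpose transpose_mat mat_0)
  then show ?thesis using that[OF P psdY] dual by (simp add: Y_def)
qed

text \<open>Polarization: the two cross terms at \<open>\<xi> + \<eta>\<close> add up to zero, and
  by symmetry they are equal.\<close>

lemma sym_mat_eq_0:
  assumes "sym_mat S" "\<And>\<xi>. \<xi> \<bullet> (S *v \<xi>) = 0"
  shows "S = 0"
proof -
  have "\<xi> \<bullet> (S *v \<eta>) = 0" for \<xi> \<eta>
  proof -
    have "\<eta> \<bullet> (S *v \<xi>) = \<xi> \<bullet> (S *v \<eta>)"
      using assms(1) by (metis dot_lmul_matrix inner_commute sym_mat_def transpose_matrix_vector)
    then show ?thesis
      using assms(2)[of "\<xi> + \<eta>"] assms(2)[of \<xi>] assms(2)[of \<eta>]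
      by (simp add: matrix_vector_right_distrib inner_add_left inner_add_right)
  qed
  then have "S *v \<eta> = 0" for \<eta>
    by (metis inner_eq_zero_iff)
  then show ?thesis
    by (metis matrix_eq matrix_vector_mult_0)
qed

text \<open>If \<open>-A = P - Y\<close> is the decomposition above, then \<open>P\<^sup>3 = -P A P\<close> forces \<open>P = 0\<close>; so \<open>A = Y\<close>
  lies in the dual cone.\<close>

lemma inner_psd_nonneg:
  fixes A B :: "real^'n^'n"
  assumes A: "psd A" and "psd B"
  shows "0 \<le> inner A B"
proof -
  obtain P Y where PY: "psd P" "psd Y" "- A = P - Y" "P ** Y = 0"
    and dual: "\<And>Z. psd Z \<Longrightarrow> 0 \<le> inner Y Z"
    using psd_moreau[of "- A"] A by (auto simp: psd_def sym_mat_minus)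
  have tP: "transpose P = P" using PY(1) by (simp add: psd_def sym_mat_def)
  define S where "S = P ** P ** P"
  have "Y = P + A" using PY(3) by (simp add: algebra_simps)
  then have "P ** P + P ** A = 0" using PY(4) by (simp add: matrix_add_ldistrib)
  then have S: "P ** A ** P = - S"
    unfolding S_def by (metis add.inverse_unique matrix_add_rdistrib times0_left)
  \<comment> \<open>\<open>S\<close> and \<open>- S = P ** A ** P\<close> are congruence transforms
    by \<open>P\<close> of the semidefinite matrices \<open>P\<close> and \<open>A\<close>.\<close>
  have "psd S" "psd (- S)"
    using psd_congruence[OF PY(1), of P] psd_congruence[OF A, of P] by (simp_all add: tP S S_def)
  then have "\<xi> \<bullet> (S *v \<xi>) = 0" for \<xi>
    unfolding psd_iff_inner inner_outer_square[symmetric] by (simp add: order_antisym)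
  then have "S = 0" using \<open>psd S\<close> by (intro sym_mat_eq_0) (auto simp: psd_def)
  \<comment> \<open>Moving factors across the inner product descends from the cube to the square and
    then to \<open>P\<close> itself.\<close>
  then have "inner (P ** P) (P ** P) = 0"
    using inner_matrix_mult_left[of P P "P ** P"] by (simp add: tP S_def matrix_mul_assoc)
  then have "inner P P = 0"
    using inner_matrix_mult_left[of P "mat 1" P] by (simp add: tP)
  then have "A = Y" using PY(3) by simp
  then show ?thesis using dual assms by simp
qed

section \<open>Uniqueness and size of the negative part\<close>

lemma inner_eq_0_if_mult_eq_0:
  fixes P Y :: "real^'n^'n"
  assumes "psd P" "P ** Y = 0" shows "inner P Y = 0"
  using assms inner_matrix_mult_left[of P "mat 1" Y] by (simp add: psd_def sym_mat_def)

text \<open>For two splittings, the squared norm of \<open>Y' - Y\<close> equals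
  \<open>inner (P' - P) (Y' - Y)\<close>. In its expansion the matching pairs are orthogonal, and
  the mixed pairs enter with a minus sign and are nonnegative by self-duality of the cone.\<close>

lemma mat_neg_part_eqI:
  assumes "psd P" "psd Y" "X = P - Y" "P ** Y = 0"
  shows "mat_neg_part X = Y"
  unfolding mat_neg_part_def
proof (rule the_equality)
  show "psd Y \<and> (\<exists>P. psd P \<and> X = P - Y \<and> P ** Y = 0)" using assms by auto
next
  fix Y' assume "psd Y' \<and> (\<exists>P. psd P \<and> X = P - Y' \<and> P ** Y' = 0)"
  then obtain P' where Y': "psd Y'" "psd P'" "X = P' - Y'" "P' ** Y' = 0" by auto
  have "Y' - Y = P' - P"
    using Y'(3) assms(3) by (simp add: algebra_simps)
  then have "inner (Y' - Y) (Y' - Y) = inner (P' - P) (Y' - Y)" by simp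
  also have "\<dots> \<le> 0"
    using inner_psd_nonneg[OF assms(1) Y'(1)] inner_psd_nonneg[OF Y'(2) assms(2)]
      inner_eq_0_if_mult_eq_0[OF assms(1,4)] inner_eq_0_if_mult_eq_0[OF Y'(2,4)]
    by (simp add: inner_diff_left inner_diff_right)
  finally show "Y' = Y" by (metis inner_gt_zero_iff not_le right_minus_eq)
qed

text \<open>Pythagoras, as \<open>P\<close> and \<open>Y\<close> are orthogonal.\<close>

lemma norm_mat_neg_part_le:
  assumes "sym_mat X"
  shows "norm (mat_neg_part X) \<le> norm X"
proof -
  obtain P Y where PY: "psd P" "psd Y" "X = P - Y" "P ** Y = 0"
    using psd_moreau[OF assms] by metis
  have "(norm Y)\<^sup>2 \<le> (norm X)\<^sup>2"
    using inner_eq_0_if_mult_eq_0[OF PY(1,4)]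
    by (simp add: power2_norm_eq_inner PY(3) inner_diff_left inner_diff_right inner_commute)
  then show ?thesis using mat_neg_part_eqI[OF PY] by simp
qed

text \<open>Pairing \<open>X + K *\<^sub>R mat 1\<close> with the negative part \<open>Y\<close>
  gives \<open>norm Y * norm Y \<le> K * inner (mat 1) Y\<close>; Cauchy-Schwarz then produces the
  Frobenius norm of the identity.\<close>

lemma norm_mat_neg_part_le_if_ge:
  fixes X :: "real^'n^'n"
  assumes "sym_mat X" "psd (X + K *\<^sub>R mat 1)" "0 \<le> K"
  shows "norm (mat_neg_part X) \<le> K * norm (mat 1 :: real^'n^'n)"
proof -
  obtain P Y where PY: "psd P" "psd Y" "X = P - Y" "P ** Y = 0"
    using psd_moreau[OF assms(1)] by metis
  have "norm Y * norm Y = - inner X Y"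
    using inner_eq_0_if_mult_eq_0[OF PY(1,4)]
    by (simp add: PY(3) inner_diff_left flip: power2_norm_eq_inner power2_eq_square)
  also have "\<dots> \<le> K * inner (mat 1) Y"
    using inner_psd_nonneg[OF assms(2) PY(2)] by (simp add: inner_add_left)
  also have "\<dots> \<le> K * (norm (mat 1 :: real^'n^'n) * norm Y)"
    by (intro mult_left_mono norm_cauchy_schwarz assms)
  finally have "norm Y * norm Y \<le> (K * norm (mat 1 :: real^'n^'n)) * norm Y" by simp
  then have "norm Y \<le> K * norm (mat 1 :: real^'n^'n)"
    using assms(3) by (cases "norm Y = 0") (auto simp: mult_le_cancel_right)
  then show ?thesis using mat_neg_part_eqI[OF PY] by simp
qed

section \<open>Smooth kernels with compact support\<close>

text \<open>The standard bump is \<open>p = 1\<close>, \<open>m = 0\<close>. The larger family is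
  closed under differentiation, so a single derivative computation yields smoothness of every
  order.\<close>

definition flat_bump :: "real poly \<Rightarrow> nat \<Rightarrow> real \<Rightarrow> real" where
  "flat_bump p m t = (if \<bar>t\<bar> < 1 then poly p t / (1 - t\<^sup>2) ^ m * exp (- (1 / (1 - t\<^sup>2))) else 0)"

text \<open>With \<open>s = 1 - t\<^sup>2\<close>, the polynomial \<open>[:1, 0, -1:]\<close>, this
  is the numerator of the derivative over the common denominator \<open>s ^ (m + 2)\<close>. The
  three terms come from differentiating \<open>p\<close>, the power of \<open>s\<close> and the
  exponential.\<close>

definition flat_bump_deriv_poly :: "real poly \<Rightarrow> nat \<Rightarrow> real poly" where
  "flat_bump_deriv_poly p m = pderiv p * [:1, 0, -1:]\<^sup>2
     + smult (2 * real m) ([:0, 1:] * [:1, 0, -1:] * p) - smult 2 ([:0, 1:] * p)"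

text \<open>The series of \<open>exp (1 / s)\<close> is bounded below by its term of degree
  \<open>n\<close>.\<close>

lemma power_mult_exp_minus_inverse_le:
  fixes s :: real
  assumes "0 < s" shows "exp (- (1 / s)) \<le> fact n * s ^ n"
proof -
  have "(1 / s) ^ n / fact n \<le> exp (1 / s)"
    using sum_le_suminf[OF summable_exp[of "1 / s"], of "{n}"] assms
    by (simp add: exp_def divide_inverse mult.commute scaleR_conv_of_real)
  then show ?thesis
    using assms by (simp add: exp_minus field_simps)
qed

lemma flat_bump_has_derivative:
  "(flat_bump p m has_real_derivative flat_bump (flat_bump_deriv_poly p m) (m + 2) t) (at t)"
proof -
  consider "\<bar>t\<bar> < 1" | "\<bar>t\<bar> > 1" | "\<bar>t\<bar> = 1" by linarith
  then show ?thesis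
  proof cases
    case 1
    have s: "1 - t\<^sup>2 > 0" using 1 by (simp add: abs_square_less_1)
    have "((\<lambda>t. poly p t / (1 - t\<^sup>2) ^ m * exp (- (1 / (1 - t\<^sup>2)))) has_real_derivative
        flat_bump (flat_bump_deriv_poly p m) (m + 2) t) (at t)"
    proof -
      define s E where "s = 1 - t\<^sup>2" and "E = exp (- inverse s)"
      define u where "u = inverse s"
      have su: "s * u = 1" using s by (simp add: u_def s_def)
      \<comment> \<open>The factor \<open>real m\<close> absorbs the truncated exponent at
        \<open>m = 0\<close>.\<close>
      have um: "real m * u ^ (m - 1) * u = real m * u ^ m" by (cases m) auto
      have du: "((\<lambda>t. inverse (1 - t\<^sup>2)) has_real_derivative 2 * t * u\<^sup>2) (at t)"
        using s by (auto intro!: derivative_eq_intros simp: u_def s_def power2_eq_square field_simps)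
      have "((\<lambda>t. poly p t * inverse (1 - t\<^sup>2) ^ m * exp (- inverse (1 - t\<^sup>2))) has_real_derivative
          poly (pderiv p) t * u ^ m * E
          + poly p t * (real m * u ^ (m - 1) * (2 * t * u\<^sup>2)) * E
          - poly p t * u ^ m * E * (2 * t * u\<^sup>2)) (at t)"
        by (rule derivative_eq_intros du poly_DERIV refl)+
          (simp add: u_def s_def E_def algebra_simps)
      also have "poly p t * (real m * u ^ (m - 1) * (2 * t * u\<^sup>2)) * E
          = poly p t * (real m * u ^ m * (2 * t * u)) * E"
        using um by (auto simp: power2_eq_square algebra_simps)
      also have "poly (pderiv p) t * u ^ m * E + poly p t * (real m * u ^ m * (2 * t * u)) * E
          - poly p t * u ^ m * E * (2 * t * u\<^sup>2)
          = poly (flat_bump_deriv_poly p m) t * u ^ (m + 2) * E"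
      proof -
        have "poly (flat_bump_deriv_poly p m) t = poly (pderiv p) t * s\<^sup>2
            + 2 * real m * t * s * poly p t - 2 * t * poly p t"
          by (simp add: flat_bump_deriv_poly_def s_def power2_eq_square algebra_simps)
        then have "poly (flat_bump_deriv_poly p m) t * u ^ (m + 2) * E
            = u ^ m * E * (poly (pderiv p) t * (s * u)\<^sup>2 + 2 * real m * t * poly p t * (s * u) * u
                - 2 * t * poly p t * u\<^sup>2)"
          by (simp only: power_add power2_eq_square) (simp add: algebra_simps)
        then show ?thesis unfolding su by (simp add: algebra_simps)
      qed
      finally show ?thesis
        using 1 by (simp add: flat_bump_def divide_inverse u_def s_def E_def power_inverse)
    qed
    then show ?thesis
      by (rule has_field_derivative_transform_within_open[where S = "{-1<..<1}"])
        (use 1 in \<open>auto simp: flat_bump_def\<close>)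
  next
    case 2
    have "((\<lambda>_. 0) has_real_derivative flat_bump (flat_bump_deriv_poly p m) (m + 2) t) (at t)"
      using 2 by (simp add: flat_bump_def)
    then show ?thesis
      by (rule has_field_derivative_transform_within_open[where S = "- {-1..1}"])
        (use 2 in \<open>auto simp: flat_bump_def\<close>)
  next
    case 3
    obtain B where B: "\<And>u. u \<in> {-1..1} \<Longrightarrow> \<bar>poly p u\<bar> \<le> B"
    proof -
      have "compact (poly p ` {-1..1})"
        by (intro compact_continuous_image continuous_intros) auto
      then show ?thesis using that
        by (metis bounded_iff compact_imp_bounded imageI real_norm_def)
    qed
    have "B \<ge> 0" using B[of 0] by auto
    \<comment> \<open>At an endpoint the bump is shown to be of second order in
      \<open>u - t\<close>, which forces derivative zero. Of the \<open>m + 2\<close> powers of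
      \<open>s\<close> gained from the exponential, \<open>m\<close> cancel the pole and two remain;
      the 4 is the square of the factor in \<open>s \<le> 2 * \<bar>u - t\<bar>\<close>.\<close>
    define C where "C = 4 * (B * fact (m + 2))"
    have bound: "\<bar>flat_bump p m u\<bar> \<le> C * \<bar>u - t\<bar>\<^sup>2" for u
    proof (cases "\<bar>u\<bar> < 1")
      case True
      define s where "s = 1 - u\<^sup>2"
      have s: "0 < s" using True by (simp add: abs_square_less_1 s_def)
      have "s = (1 - u) * (1 + u)" by (simp add: s_def power2_eq_square algebra_simps)
      also have "\<dots> \<le> 2 * \<bar>u - t\<bar>"
      proof (cases "t = 1")
        case t: True
        have "(1 - u) * (1 + u) \<le> (1 - u) * 2" using True by (intro mult_left_mono) auto
        then show ?thesis using True t by auto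
      next
        case False
        have "(1 - u) * (1 + u) \<le> 2 * (1 + u)" using True by (intro mult_right_mono) auto
        then show ?thesis using True False 3 by auto
      qed
      finally have s2: "s \<le> 2 * \<bar>u - t\<bar>" .
      have "\<bar>flat_bump p m u\<bar> = \<bar>poly p u\<bar> / s ^ m * exp (- (1 / s))"
        using True s by (simp add: flat_bump_def s_def abs_mult)
      also have "\<dots> \<le> B / s ^ m * (fact (m + 2) * s ^ (m + 2))"
      proof (intro mult_mono divide_right_mono)
        show "\<bar>poly p u\<bar> \<le> B" using B[of u] True by (auto simp: abs_less_iff)
        show "exp (- (1 / s)) \<le> fact (m + 2) * s ^ (m + 2)"
          by (rule power_mult_exp_minus_inverse_le[OF s])
      qed (use s \<open>B \<ge> 0\<close> in auto)
      also have "\<dots> = B * fact (m + 2) * s\<^sup>2"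
        using s by (simp add: power_add power2_eq_square del: fact_Suc)
      also have "\<dots> \<le> B * fact (m + 2) * (2 * \<bar>u - t\<bar>)\<^sup>2"
        using s s2 \<open>B \<ge> 0\<close> by (intro mult_left_mono power_mono) auto
      finally show ?thesis by (simp add: C_def power_mult_distrib mult_ac del: fact_Suc)
    qed (auto simp: flat_bump_def C_def \<open>B \<ge> 0\<close>)
    have "((\<lambda>u. (flat_bump p m u - flat_bump p m t) / (u - t)) \<longlongrightarrow> 0) (at t)"
    proof (rule Lim_null_comparison)
      show "\<forall>\<^sub>F u in at t. norm ((flat_bump p m u - flat_bump p m t) / (u - t)) \<le> C * \<bar>u - t\<bar>"
      proof (rule eventually_at_filter[THEN iffD2], rule always_eventually, intro allI impI)
        fix u assume "u \<noteq> t"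
        then show "norm ((flat_bump p m u - flat_bump p m t) / (u - t)) \<le> C * \<bar>u - t\<bar>"
          using bound[of u] 3 by (simp add: flat_bump_def[of _ _ t] power2_eq_square field_simps)
      qed
      show "((\<lambda>u. C * \<bar>u - t\<bar>) \<longlongrightarrow> 0) (at t)"
        by (rule tendsto_eq_intros refl | simp)+
    qed
    then show ?thesis
      using 3 by (simp add: has_field_derivative_iff flat_bump_def[of "flat_bump_deriv_poly p m"])
  qed
qed

section \<open>Product kernels on the cube\<close>

definition flat_bumps :: "(real \<Rightarrow> real) set" where
  "flat_bumps = {flat_bump p m | p m. True}"

lemma flat_bumps_deriv:
  assumes "b \<in> flat_bumps"
  shows "(b has_real_derivative deriv b t) (at t)" "deriv b \<in> flat_bumps"
proof -
  obtain p m where b: "b = flat_bump p m" using assms by (auto simp: flat_bumps_def)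
  have d: "deriv b = flat_bump (flat_bump_deriv_poly p m) (m + 2)"
    unfolding b using DERIV_imp_deriv[OF flat_bump_has_derivative] by auto
  show "(b has_real_derivative deriv b t) (at t)"
    unfolding d unfolding b by (rule flat_bump_has_derivative)
  show "deriv b \<in> flat_bumps" unfolding d by (auto simp: flat_bumps_def)
qed

lemma flat_bumps_eq_0: "b \<in> flat_bumps \<Longrightarrow> 1 \<le> \<bar>t\<bar> \<Longrightarrow> b t = 0"
  by (auto simp: flat_bumps_def flat_bump_def)

text \<open>In a product of one-variable functions a partial derivative changes a single factor.
  Hence the kernels are closed under \<open>partial\<close>, and mixed partials commute because they
  update different factors.\<close>

definition tensor :: "('n \<Rightarrow> real \<Rightarrow> real) \<Rightarrow> real^'n \<Rightarrow> real" where
  "tensor b y = (\<Prod>i\<in>UNIV. b i (y $ i))"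

definition bump_kernels :: "(real^'n \<Rightarrow> real) set" where
  "bump_kernels = {tensor b | b. \<forall>i. b i \<in> flat_bumps}"

lemma partial_eqI:
  assumes "(f has_derivative f') (at x)" shows "partial i f x = f' (axis i 1)"
  using frechet_derivative_at[OF assms] by (simp add: partial_def)

lemma tensor_has_derivative:
  assumes "\<And>i. b i \<in> flat_bumps"
  shows "(tensor b has_derivative (\<lambda>h. \<Sum>i\<in>UNIV. h $ i * tensor (b(i := deriv (b i))) y)) (at y)"
proof -
  have "((\<lambda>y. b i (y $ i)) has_derivative (\<lambda>h. h $ i * deriv (b i) (y $ i))) (at y)" for i
    using has_derivative_compose[OF bounded_linear_imp_has_derivative[OF bounded_linear_vec_nth, of i]
        flat_bumps_deriv(1)[OF assms, of i "y $ i", unfolded has_field_derivative_def]]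
    by (simp add: mult.commute)
  then have "((\<lambda>y. \<Prod>i\<in>UNIV. b i (y $ i)) has_derivative
      (\<lambda>h. \<Sum>i\<in>UNIV. h $ i * deriv (b i) (y $ i) * (\<Prod>j\<in>UNIV - {i}. b j (y $ j)))) (at y)"
    by (intro has_derivative_prod) auto
  moreover have "deriv (b i) (y $ i) * (\<Prod>j\<in>UNIV - {i}. b j (y $ j)) = tensor (b(i := deriv (b i))) y" for i
    unfolding tensor_def by (subst (2) prod.remove[of _ i]) auto
  ultimately show ?thesis by (simp add: tensor_def[of b, abs_def] mult.assoc)
qed

lemma partial_tensor:
  assumes "\<And>i. b i \<in> flat_bumps"
  shows "partial i (tensor b) = tensor (b(i := deriv (b i)))"
proof
  fix y
  have "partial i (tensor b) y = (\<Sum>j\<in>UNIV. axis i 1 $ j * tensor (b(j := deriv (b j))) y)"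
    by (rule partial_eqI[OF tensor_has_derivative[OF assms]])
  also have "\<dots> = (\<Sum>j\<in>UNIV. if j = i then tensor (b(j := deriv (b j))) y else 0)"
    by (rule sum.cong) (auto simp: axis_def)
  finally show "partial i (tensor b) y = tensor (b(i := deriv (b i))) y" by simp
qed

lemma bump_kernels_has_derivative:
  assumes "k \<in> bump_kernels"
  shows "(k has_derivative (\<lambda>h. \<Sum>i\<in>UNIV. h $ i * partial i k y)) (at y)"
  using assms by (auto simp: bump_kernels_def partial_tensor intro!: tensor_has_derivative)

lemma bump_kernels_partial:
  assumes "k \<in> bump_kernels" shows "partial i k \<in> bump_kernels"
proof -
  obtain b where b: "k = tensor b" "\<And>i. b i \<in> flat_bumps"
    using assms by (auto simp: bump_kernels_def)
  then show ?thesis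
    unfolding bump_kernels_def b(1) partial_tensor[OF b(2)]
    by (intro CollectI exI[of _ "b(i := deriv (b i))"]) (auto intro: flat_bumps_deriv)
qed

lemma bump_kernels_partial_commute:
  assumes "k \<in> bump_kernels"
  shows "partial i (partial j k) = partial j (partial i k)"
proof (cases "i = j")
  case False
  obtain b where b: "k = tensor b" "\<And>i. b i \<in> flat_bumps"
    using assms by (auto simp: bump_kernels_def)
  then have "(b(i := deriv (b i))) j' \<in> flat_bumps" for i j'
    by (auto intro: flat_bumps_deriv)
  then show ?thesis
    using False b by (simp add: partial_tensor fun_upd_twist)
qed simp

lemma bump_kernels_eq_0:
  assumes "k \<in> bump_kernels" "y \<notin> cbox (-1) 1" shows "k y = 0"
proof -
  obtain b where b: "k = tensor b" "\<And>i. b i \<in> flat_bumps"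
    using assms by (auto simp: bump_kernels_def)
  obtain i where "\<not> (- 1 \<le> y $ i \<and> y $ i \<le> 1)" using assms(2) by (auto simp: mem_box_cart)
  then have "1 \<le> \<bar>y $ i\<bar>" by linarith
  then show ?thesis
    unfolding b tensor_def using flat_bumps_eq_0[OF b(2)] by (intro prod_zero) auto
qed

lemma bump_kernels_continuous: "k \<in> bump_kernels \<Longrightarrow> continuous_on S k"
  by (meson bump_kernels_has_derivative continuous_at_imp_continuous_on has_derivative_continuous)

lemma Ck_bump_kernels: "k \<in> bump_kernels \<Longrightarrow> Ck n k"
proof (induction n arbitrary: k)
  case 0
  then show ?case by (simp add: bump_kernels_continuous)
next
  case (Suc n)
  then show ?case
    by (auto simp: bump_kernels_partial differentiable_on_def differentiable_def
        intro: bump_kernels_has_derivative has_derivative_at_withinI)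
qed

section \<open>Differentiation under the integral sign\<close>

lemma integrable_continuous_compact_support:
  fixes h :: "'a::euclidean_space \<Rightarrow> real"
  assumes "continuous_on S h" "compact S" "\<And>y. y \<notin> S \<Longrightarrow> h y = 0"
  shows "integrable lborel h"
proof -
  have "integrable lborel (\<lambda>y. indicator S y *\<^sub>R h y)"
    by (rule borel_integrable_compact) (use assms in auto)
  also have "(\<lambda>y. indicator S y *\<^sub>R h y) = h"
    using assms(3) by (fastforce simp: indicator_def)
  finally show ?thesis .
qed

text \<open>The kernel is evaluated at \<open>y - x\<close>, not \<open>x - y\<close>: substituting
  \<open>y = x + z\<close> then averages \<open>f (x + z)\<close> with weight \<open>k z\<close>, at
  the price of a minus sign per derivative, which cancels in the Hessian.\<close>

definition mollify :: "(real^'n \<Rightarrow> real) \<Rightarrow> (real^'n \<Rightarrow> real) \<Rightarrow> real^'n \<Rightarrow> real" where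
  "mollify k f x = (\<integral>y. f y * k (y - x) \<partial>lborel)"

lemma integrable_mollify:
  fixes f k :: "real^'n \<Rightarrow> real"
  assumes f: "continuous_on UNIV f" and k: "k \<in> bump_kernels"
  shows "integrable lborel (\<lambda>y. f y * k (y - x))"
proof (rule integrable_continuous_compact_support)
  show "continuous_on (cbox (x - 1) (x + 1)) (\<lambda>y. f y * k (y - x))"
    by (intro continuous_intros continuous_on_subset[OF f]
        continuous_on_compose2[OF bump_kernels_continuous[OF k, of UNIV]]) auto
  show "compact (cbox (x - 1) (x + 1))" by (rule compact_cbox)
  fix y assume "y \<notin> cbox (x - 1) (x + 1)"
  then have "y - x \<notin> cbox (-1) 1" by (auto simp: mem_box_cart algebra_simps)
  then show "f y * k (y - x) = 0" using bump_kernels_eq_0[OF k] by simp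
qed

text \<open>The Leibniz rule needs a domain of integration that does not move with \<open>z\<close>.
  The half-width 2 is the half-width 1 of the kernel's cube plus the radius 1 of the ball.\<close>

lemma mollify_eq_integral:
  fixes f k :: "real^'n \<Rightarrow> real"
  assumes f: "continuous_on UNIV f" and k: "k \<in> bump_kernels" and z: "z \<in> ball x 1"
  shows "mollify k f z = integral (cbox (x - 2 *\<^sub>R 1) (x + 2 *\<^sub>R 1)) (\<lambda>y. f y * k (y - z))"
proof -
  have "f y * k (y - z) = 0" if "y \<notin> cbox (x - 2 *\<^sub>R 1) (x + 2 *\<^sub>R 1)" for y
  proof -
    have "\<bar>(x - z) $ i\<bar> \<le> 1" for i
      using component_le_norm_cart[of "x - z" i] z by (simp add: dist_norm)
    then have "y - z \<notin> cbox (-1) 1"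
      using that unfolding mem_box_cart by simp (smt (verit))
    then show ?thesis using bump_kernels_eq_0[OF k] by simp
  qed
  then have *: "(\<lambda>y. f y * k (y - z)) = (\<lambda>y. if y \<in> cbox (x - 2 *\<^sub>R 1) (x + 2 *\<^sub>R 1) then f y * k (y - z) else 0)"
    by auto
  show ?thesis
    unfolding mollify_def integral_lborel[OF integrable_mollify[OF f k], symmetric]
    by (subst (1) *) (rule integral_restrict_UNIV)
qed

lemma mollify_has_derivative:
  fixes f k :: "real^'n \<Rightarrow> real"
  assumes f: "continuous_on UNIV f" and k: "k \<in> bump_kernels"
  shows "(mollify k f has_derivative (\<lambda>h. \<Sum>i\<in>UNIV. h $ i * - mollify (partial i k) f x)) (at x)"
proof -
  define a b where "a = x - 2 *\<^sub>R 1" and "b = x + 2 *\<^sub>R (1::real^'n)"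
  \<comment> \<open>The derivative in \<open>z\<close> as a bounded linear functional, the form in
    which the Leibniz rule takes it; pairing with \<open>axis i 1\<close> reads off
    \<open>h $ i\<close>.\<close>
  define fx where "fx z y = (\<Sum>i\<in>UNIV. (- (f y * partial i k (y - z))) *\<^sub>R
      blinfun_inner_right (axis i 1 :: real^'n))" for z y
  have cont: "continuous_on S (\<lambda>p. f (snd p) * k (snd p - fst p))" if "k \<in> bump_kernels"
    for S and k :: "real^'n \<Rightarrow> real"
    by (intro continuous_intros continuous_on_compose2[OF f]
        continuous_on_compose2[OF bump_kernels_continuous[OF that, of UNIV]]) auto
  have cont': "continuous_on S (\<lambda>y. f y * k (y - z))" if "k \<in> bump_kernels"
    for S z and k :: "real^'n \<Rightarrow> real"
    by (intro continuous_intros continuous_on_subset[OF f]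
        continuous_on_compose2[OF bump_kernels_continuous[OF that, of UNIV]]) auto
  have "((\<lambda>z. integral (cbox a b) (\<lambda>y. f y * k (y - z))) has_derivative
      blinfun_apply (integral (cbox a b) (fx x))) (at x within ball x 1)"
  proof (rule leibniz_rule)
    fix z y
    have "((\<lambda>z. k (y - z)) has_derivative (\<lambda>h. \<Sum>i\<in>UNIV. (- h) $ i * partial i k (y - z))) (at z within ball x 1)"
      by (rule has_derivative_compose[OF _ bump_kernels_has_derivative[OF k]])
        (auto intro!: derivative_eq_intros)
    from has_derivative_mult_right[OF this, of "f y"]
    show "((\<lambda>z. f y * k (y - z)) has_derivative blinfun_apply (fx z y)) (at z within ball x 1)"
      by (rule has_derivative_eq_rhs)
        (auto simp: fx_def blinfun.sum_left blinfun.scaleR_left blinfun.minus_left inner_axis' sum_distrib_left mult_ac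
          intro!: sum.cong)
  next
    show "(\<lambda>y. f y * k (y - z)) integrable_on cbox a b" for z
      by (intro integrable_continuous cont' k)
    have "continuous_on (ball x 1 \<times> cbox a b) (\<lambda>p. fx (fst p) (snd p))"
      unfolding fx_def by (intro continuous_intros cont bump_kernels_partial k)
    then show "continuous_on (ball x 1 \<times> cbox a b) (\<lambda>(z, y). fx z y)"
      by (simp add: case_prod_beta)
  qed auto
  also have "blinfun_apply (integral (cbox a b) (fx x)) = (\<lambda>h. \<Sum>i\<in>UNIV. h $ i * - mollify (partial i k) f x)"
  proof -
    have *: "((\<lambda>y. f y * partial i k (y - x)) has_integral mollify (partial i k) f x) (cbox a b)" for i
      unfolding a_def b_def
      by (subst mollify_eq_integral[where x = x])
        (auto intro!: f bump_kernels_partial k integrable_integral integrable_continuous cont')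
    have "(fx x has_integral (\<Sum>i\<in>UNIV. (- mollify (partial i k) f x) *\<^sub>R
        blinfun_inner_right (axis i 1 :: real^'n))) (cbox a b)"
      unfolding fx_def by (intro has_integral_sum has_integral_scaleR_left has_integral_neg *) auto
    then show ?thesis
      by (subst integral_unique, assumption)
        (auto simp: blinfun.sum_left blinfun.scaleR_left blinfun.minus_left inner_axis' mult_ac)
  qed
  finally have "((\<lambda>z. integral (cbox a b) (\<lambda>y. f y * k (y - z))) has_derivative
      (\<lambda>h. \<Sum>i\<in>UNIV. h $ i * - mollify (partial i k) f x)) (at x within ball x 1)" .
  moreover have x: "x \<in> ball x 1" by simp
  moreover have "integral (cbox a b) (\<lambda>y. f y * k (y - z)) = mollify k f z" if "z \<in> ball x 1" for z
    unfolding a_def b_def by (rule mollify_eq_integral[OF f k that, symmetric])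
  ultimately have "(mollify k f has_derivative (\<lambda>h. \<Sum>i\<in>UNIV. h $ i * - mollify (partial i k) f x))
      (at x within ball x 1)"
    by (intro has_derivative_transform[of x "ball x 1" "mollify k f"]) auto
  then show ?thesis
    unfolding at_within_open[OF x open_ball] .
qed

section \<open>Affine changes of variable and added constants\<close>

lemma partial_affine:
  fixes f :: "real^'n \<Rightarrow> real"
  assumes "f differentiable (at (c *\<^sub>R x + a))"
  shows "((\<lambda>x. s * f (c *\<^sub>R x + a)) has_derivative
      (\<lambda>h. s * frechet_derivative f (at (c *\<^sub>R x + a)) (c *\<^sub>R h))) (at x)"
    and "partial i (\<lambda>x. s * f (c *\<^sub>R x + a)) x = s * c * partial i f (c *\<^sub>R x + a)"
proof -
  let ?f' = "frechet_derivative f (at (c *\<^sub>R x + a))"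
  have f': "(f has_derivative ?f') (at (c *\<^sub>R x + a))"
    using assms by (rule frechet_derivative_works[THEN iffD1])
  have "((\<lambda>x. c *\<^sub>R x + a) has_derivative (\<lambda>h. c *\<^sub>R h)) (at x)"
    by (auto intro!: derivative_eq_intros)
  from has_derivative_compose[OF this f']
  have "((\<lambda>x. f (c *\<^sub>R x + a)) has_derivative (\<lambda>h. ?f' (c *\<^sub>R h))) (at x)" .
  then show d: "((\<lambda>x. s * f (c *\<^sub>R x + a)) has_derivative (\<lambda>h. s * ?f' (c *\<^sub>R h))) (at x)"
    by (rule has_derivative_mult_right)
  show "partial i (\<lambda>x. s * f (c *\<^sub>R x + a)) x = s * c * partial i f (c *\<^sub>R x + a)"
    using linear_cmul[OF has_derivative_linear[OF f']] unfolding partial_eqI[OF d]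
    by (simp add: partial_def)
qed

lemma Ck_affine:
  fixes f :: "real^'n \<Rightarrow> real"
  assumes "Ck n f" shows "Ck n (\<lambda>x. s * f (c *\<^sub>R x + a))"
  using assms
proof (induction n arbitrary: f s)
  case 0
  then have "continuous_on UNIV f" by simp
  then show ?case
    by (auto intro!: continuous_intros continuous_on_compose2[of UNIV f])
next
  case (Suc n)
  then have d: "f differentiable (at y)" for y
    by (simp add: differentiable_on_def)
  have "partial i (\<lambda>x. s * f (c *\<^sub>R x + a)) = (\<lambda>x. (s * c) * partial i f (c *\<^sub>R x + a))" for i
    using partial_affine(2)[OF d] by auto
  moreover have "(\<lambda>x. s * f (c *\<^sub>R x + a)) differentiable (at x)" for x
    unfolding differentiable_def using partial_affine(1)[OF d] by blast
  ultimately show ?case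
    using Suc by (auto simp: differentiable_on_def)
qed

lemma Ck_2_D:
  assumes "Ck 2 f"
  shows "f differentiable (at x)" "partial i f differentiable (at x)"
  using assms by (auto simp: numeral_2_eq_2 differentiable_on_def)

lemma grad_affine:
  assumes "Ck 2 f" shows "grad (\<lambda>x. f (c *\<^sub>R x + a)) x = c *\<^sub>R grad f (c *\<^sub>R x + a)"
  using partial_affine(2)[OF Ck_2_D(1)[OF assms], of _ 1]
  by (simp add: grad_def vec_eq_iff)

lemma hess_affine:
  assumes "Ck 2 f" shows "hess (\<lambda>x. f (c *\<^sub>R x + a)) x = c\<^sup>2 *\<^sub>R hess f (c *\<^sub>R x + a)"
proof -
  have "partial i (\<lambda>x. f (c *\<^sub>R x + a)) = (\<lambda>x. c * partial i f (c *\<^sub>R x + a))" for i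
    using partial_affine(2)[OF Ck_2_D(1)[OF assms], of i 1] by auto
  then show ?thesis
    using partial_affine(2)[OF Ck_2_D(2)[OF assms], of _ c]
    by (simp add: hess_def vec_eq_iff power2_eq_square)
qed

lemma partial_add_const:
  assumes "\<And>x. f differentiable (at x)"
  shows "partial i (\<lambda>x. f x + d) = partial i f"
proof
  fix x
  have "((\<lambda>x. f x + d) has_derivative frechet_derivative f (at x)) (at x)"
    using has_derivative_add[OF assms[unfolded frechet_derivative_works] has_derivative_const] by simp
  then show "partial i (\<lambda>x. f x + d) x = partial i f x"
    unfolding partial_def[of i f] by (rule partial_eqI)
qed

lemma Ck_2_add_const:
  assumes "Ck 2 f"
  shows "Ck 2 (\<lambda>x. f x + d)" "grad (\<lambda>x. f x + d) = grad f" "hess (\<lambda>x. f x + d) = hess f"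
proof -
  have p: "partial i (\<lambda>x. f x + d) = partial i f" for i
    by (rule partial_add_const[OF Ck_2_D(1)[OF assms]])
  show "grad (\<lambda>x. f x + d) = grad f" "hess (\<lambda>x. f x + d) = hess f"
    by (simp_all add: grad_def[abs_def] hess_def[abs_def] p)
  show "Ck 2 (\<lambda>x. f x + d)"
    using assms by (auto simp: numeral_2_eq_2 p differentiable_on_def intro!: differentiable_add)
qed

section \<open>Mollification\<close>

lemma partial_mollify:
  assumes "continuous_on UNIV f" "k \<in> bump_kernels"
  shows "partial i (mollify k f) = (\<lambda>x. - mollify (partial i k) f x)"
proof
  fix x
  have "partial i (mollify k f) x = (\<Sum>j\<in>UNIV. axis i 1 $ j * - mollify (partial j k) f x)"
    by (rule partial_eqI[OF mollify_has_derivative[OF assms]])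
  also have "\<dots> = (\<Sum>j\<in>UNIV. if j = i then - mollify (partial j k) f x else 0)"
    by (rule sum.cong) (auto simp: axis_def)
  finally show "partial i (mollify k f) x = - mollify (partial i k) f x" by simp
qed

lemma mollify_differentiable:
  "continuous_on UNIV f \<Longrightarrow> k \<in> bump_kernels \<Longrightarrow> mollify k f differentiable (at x)"
  using mollify_has_derivative differentiable_def by blast

lemma Ck_mollify:
  assumes "continuous_on UNIV f" "k \<in> bump_kernels" shows "Ck n (mollify k f)"
  using assms(2)
proof (induction n arbitrary: k)
  case 0
  then show ?case
    using mollify_differentiable[OF assms(1)]
    by (auto simp: differentiable_on_def intro!: differentiable_imp_continuous_on)
next
  case (Suc n)
  then show ?case
    using Ck_affine[OF Suc.IH[OF bump_kernels_partial], where s = "-1" and c = 1 and a = 0]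
      mollify_differentiable[OF assms(1)]
    by (auto simp: differentiable_on_def partial_mollify[OF assms(1)])
qed

lemma hess_mollify:
  assumes "continuous_on UNIV f" "k \<in> bump_kernels"
  shows "hess (mollify k f) x = (\<chi> i j. mollify (partial j (partial i k)) f x)"
  using partial_affine(2)[OF mollify_differentiable[OF assms(1) bump_kernels_partial[OF assms(2)]],
      where s = "-1" and c = 1 and a = 0] assms bump_kernels_partial[OF assms(2)]
  by (simp add: hess_def partial_mollify vec_eq_iff)

lemma sym_mat_hess_mollify:
  assumes "continuous_on UNIV f" "k \<in> bump_kernels"
  shows "sym_mat (hess (mollify k f) x)"
  using bump_kernels_partial_commute[OF assms(2)]
  by (metis (lifting) sym_mat_iff hess_mollify[OF assms] vec_lambda_beta)

section \<open>Integrals against kernels\<close>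

lemma lborel_integral_shift:
  fixes h :: "'a::euclidean_space \<Rightarrow> real"
  assumes "h \<in> borel_measurable borel"
  shows "(\<integral>y. h y \<partial>lborel) = (\<integral>z. h (x + z) \<partial>lborel)"
proof -
  have "(\<integral>y. h y \<partial>lborel) = (\<integral>y. h y \<partial>distr lborel borel ((+) x))"
    by (simp only: lborel_distr_plus)
  also have "\<dots> = (\<integral>z. h (x + z) \<partial>lborel)"
    using assms by (intro integral_distr) auto
  finally show ?thesis .
qed

lemma lborel_integral_scale:
  fixes h :: "'a::euclidean_space \<Rightarrow> real"
  assumes [measurable]: "h \<in> borel_measurable borel" and "0 < c"
  shows "(\<integral>y. h y \<partial>lborel) = c ^ DIM('a) * (\<integral>z. h (c *\<^sub>R z) \<partial>lborel)"
proof -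
  have "(\<integral>y. h y \<partial>lborel)
      = (\<integral>y. h y \<partial>density (distr lborel borel (\<lambda>x. c *\<^sub>R x)) (\<lambda>_. ennreal (c ^ DIM('a))))"
    using lborel_affine[of c "0::'a"] assms(2) by simp
  also have "\<dots> = (\<integral>z. c ^ DIM('a) * h (c *\<^sub>R z) \<partial>lborel)"
    using assms(2) by (simp add: integral_density integral_distr)
  finally show ?thesis by simp
qed

lemma mollify_eq_shift:
  assumes f: "continuous_on UNIV f" and k: "k \<in> bump_kernels"
  shows "mollify k f x = (\<integral>z. f (x + z) * k z \<partial>lborel)"
  unfolding mollify_def
  by (subst lborel_integral_shift[where x = x])
    (auto intro!: borel_measurable_continuous_onI continuous_intros f
        continuous_on_compose2[OF bump_kernels_continuous[OF k, of UNIV]])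

lemma integrable_mult_kernel:
  assumes "continuous_on UNIV f" "k \<in> bump_kernels"
  shows "integrable lborel (\<lambda>z. f z * k z)"
  using integrable_mollify[OF assms, of 0] by simp

lemma integrable_kernel: "k \<in> bump_kernels \<Longrightarrow> integrable lborel k"
  using integrable_mult_kernel[of "\<lambda>_. 1" k] by simp

lemma integral_mult_kernel_bound:
  assumes f: "continuous_on UNIV f" and k: "k \<in> bump_kernels"
    and "\<And>z. z \<in> cbox (-1) 1 \<Longrightarrow> \<bar>f z\<bar> \<le> \<omega>"
  shows "\<bar>\<integral>z. f z * k z \<partial>lborel\<bar> \<le> \<omega> * (\<integral>z. \<bar>k z\<bar> \<partial>lborel)"
proof -
  have "\<bar>\<integral>z. f z * k z \<partial>lborel\<bar> \<le> (\<integral>z. \<bar>f z * k z\<bar> \<partial>lborel)"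
    by (rule integral_abs_bound)
  also have "\<dots> \<le> (\<integral>z. \<omega> * \<bar>k z\<bar> \<partial>lborel)"
  proof (rule integral_mono)
    show "integrable lborel (\<lambda>z. \<bar>f z * k z\<bar>)" "integrable lborel (\<lambda>z. \<omega> * \<bar>k z\<bar>)"
      using integrable_mult_kernel[OF f k] integrable_kernel[OF k] by simp_all
    show "\<bar>f z * k z\<bar> \<le> \<omega> * \<bar>k z\<bar>" for z
      using assms(3)[of z] bump_kernels_eq_0[OF k, of z]
      by (cases "z \<in> cbox (-1) 1") (auto simp: abs_mult intro!: mult_right_mono)
  qed
  finally show ?thesis by simp
qed

text \<open>Mollifying the constant 1 gives a constant, whose derivative is, up to sign, this
  integral.\<close>

lemma integral_partial_kernel:
  assumes "k \<in> bump_kernels"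
  shows "(\<integral>z. partial i k z \<partial>lborel) = 0"
proof -
  have "mollify k (\<lambda>_. 1) = (\<lambda>x. \<integral>z. k z \<partial>lborel)"
    using mollify_eq_shift[OF _ assms, of "\<lambda>_. 1"] by auto
  moreover have "partial i (\<lambda>x. \<integral>z. k z \<partial>lborel) = (\<lambda>x. 0)"
    using partial_eqI[OF has_derivative_const] by blast
  ultimately have "mollify (partial i k) (\<lambda>_. 1) 0 = 0"
    using partial_mollify[OF _ assms, of "\<lambda>_. 1" i] by (auto dest: fun_cong)
  then show ?thesis by (simp add: mollify_def)
qed

text \<open>A differentiated kernel has mean zero, so \<open>f x\<close> may be subtracted under the
  integral. The oscillation of \<open>f\<close> replaces its supremum, and the Hoelder exponent of
  \<open>g\<close> enters the derivative bounds through it.\<close>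

lemma mollify_partial_bound:
  fixes f k :: "real^'n \<Rightarrow> real"
  assumes f: "continuous_on UNIV f" and k: "k \<in> bump_kernels"
    and \<omega>: "\<And>z. z \<in> cbox (-1) 1 \<Longrightarrow> \<bar>f (x + z) - f x\<bar> \<le> \<omega>"
  shows "\<bar>mollify (partial i k) f x\<bar> \<le> \<omega> * (\<integral>z. \<bar>partial i k z\<bar> \<partial>lborel)"
proof -
  note k' = bump_kernels_partial[OF k, of i]
  have c: "continuous_on UNIV (\<lambda>z. f (x + z))"
    by (intro continuous_on_compose2[OF f] continuous_intros) auto
  have "mollify (partial i k) f x = (\<integral>z. f (x + z) * partial i k z - f x * partial i k z \<partial>lborel)"
    using integrable_mult_kernel[OF c k'] integrable_kernel[OF k']
    by (simp add: mollify_eq_shift[OF f k'] integral_partial_kernel[OF k])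
  also have "\<dots> = (\<integral>z. (f (x + z) - f x) * partial i k z \<partial>lborel)"
    by (simp add: left_diff_distrib)
  finally show ?thesis
    using integral_mult_kernel_bound[of "\<lambda>z. f (x + z) - f x", OF _ k' \<omega>] c
    by (simp add: continuous_intros)
qed

lemma standard_mollifier:
  obtains \<rho> :: "real^'n \<Rightarrow> real" where "\<rho> \<in> bump_kernels" "\<And>z. 0 \<le> \<rho> z" "(\<integral>z. \<rho> z \<partial>lborel) = 1"
proof -
  define b where "b c = flat_bump [:c:] 0" for c
  define \<rho> :: "real \<Rightarrow> real^'n \<Rightarrow> real" where "\<rho> c = tensor (\<lambda>_. b c)" for c
  have \<rho>_kernel: "\<rho> c \<in> bump_kernels" for c
    by (auto simp: \<rho>_def bump_kernels_def b_def flat_bumps_def)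
  have \<rho>_nonneg: "0 \<le> \<rho> c z" if "0 \<le> c" for c z
    using that by (auto simp: \<rho>_def tensor_def b_def flat_bump_def intro!: prod_nonneg)
  have \<rho>_scale: "\<rho> c z = c ^ CARD('n) * \<rho> 1 z" for c z
  proof -
    have "b c t = c * b 1 t" for t by (simp add: b_def flat_bump_def)
    then show ?thesis by (simp add: \<rho>_def tensor_def prod.distrib)
  qed
  define J where "J = (\<integral>z. \<rho> 1 z \<partial>lborel)"
  \<comment> \<open>A continuous nonnegative function with zero integral over the cube vanishes
    there, but the bump is nonzero at the origin.\<close>
  have "J \<noteq> 0"
  proof
    assume "J = 0"
    have "(\<rho> 1 has_integral J) UNIV"
      unfolding J_def by (rule has_integral_integral_lborel[OF integrable_kernel[OF \<rho>_kernel]])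
    moreover have "\<rho> 1 = (\<lambda>z. if z \<in> cbox (-1) 1 then \<rho> 1 z else 0)"
      using bump_kernels_eq_0[OF \<rho>_kernel] by auto
    ultimately have "((\<lambda>z. if z \<in> cbox (-1) 1 then \<rho> 1 z else 0) has_integral 0) UNIV"
      using \<open>J = 0\<close> by metis
    then have zero: "(\<rho> 1 has_integral 0) (cbox (-1) 1)"
      by (simp only: has_integral_restrict_UNIV)
    have "(0::real^'n) \<in> box (-1) 1" "(0::real^'n) \<in> cbox (-1) 1"
      by (simp_all add: mem_box_cart)
    then have "box (-1) (1::real^'n) \<noteq> {}" "(0::real^'n) \<in> cbox (-1) 1" by auto
    then have "\<rho> 1 0 = 0"
      by (intro has_integral_0_cbox_imp_0[OF bump_kernels_continuous[OF \<rho>_kernel] \<rho>_nonneg zero]) auto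
    moreover have "\<rho> 1 0 \<noteq> 0" by (simp add: \<rho>_def tensor_def b_def flat_bump_def)
    ultimately show False by simp
  qed
  moreover have "J \<ge> 0" unfolding J_def by (intro integral_nonneg_AE always_eventually allI \<rho>_nonneg) auto
  ultimately have J: "J > 0" by simp
  \<comment> \<open>The coefficient \<open>c\<close> enters once per coordinate, so the integral
    scales with \<open>c ^ CARD('n)\<close>.\<close>
  define c where "c = root CARD('n) (1 / J)"
  have c: "0 \<le> c" "c ^ CARD('n) = 1 / J"
    using J by (auto simp: c_def real_root_pow_pos2)
  have "(\<integral>z. \<rho> c z \<partial>lborel) = c ^ CARD('n) * J"
    unfolding J_def by (subst \<rho>_scale) simp
  then have "(\<integral>z. \<rho> c z \<partial>lborel) = 1" using c J by simp
  then show ?thesis using that \<rho>_kernel \<rho>_nonneg c(1) by blast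
qed

section \<open>Approximation of \<open>g\<close> at scale \<delta>\<close>

lemma norm_le_sum_norm_nth: "norm x \<le> (\<Sum>i\<in>UNIV. norm (x $ i))"
  unfolding norm_vec_def by (rule L2_set_le_sum) simp

lemma holder_imp_continuous:
  fixes g :: "'a::real_normed_vector \<Rightarrow> real"
  assumes "0 < \<mu>" "\<And>x y. \<bar>g x - g y\<bar> \<le> L * norm (x - y) powr \<mu>"
  shows "continuous_on UNIV g"
proof (intro continuous_at_imp_continuous_on ballI)
  fix x :: 'a
  have "((\<lambda>y. norm (y - x) powr \<mu>) \<longlongrightarrow> 0) (at x)"
    using assms(1)
    by (intro tendsto_zero_powrI[where b = \<mu>] tendsto_const tendsto_norm_zero LIM_zero tendsto_ident_at) auto
  from tendsto_mult_right_zero[OF this, of L]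
  have "((\<lambda>y. g y - g x) \<longlongrightarrow> 0) (at x)"
    by (rule Lim_null_comparison[rotated]) (use assms(2) in auto)
  then show "isCont g x"
    by (simp add: isCont_def LIM_zero_iff)
qed

lemma test_function_kernel:
  fixes \<rho> :: "real^'n \<Rightarrow> real"
  assumes \<rho>: "\<rho> \<in> bump_kernels" and "0 < \<delta>"
  shows "test_function (\<lambda>u. \<rho> ((1 / \<delta>) *\<^sub>R u + a))"
  unfolding test_function_def
proof (intro conjI allI)
  show "Ck k (\<lambda>u. \<rho> ((1 / \<delta>) *\<^sub>R u + a))" for k
    using Ck_affine[OF Ck_bump_kernels[OF \<rho>], of k 1 "1 / \<delta>" a] by simp
  have "{u. \<rho> ((1 / \<delta>) *\<^sub>R u + a) \<noteq> 0} \<subseteq> (\<lambda>w. \<delta> *\<^sub>R (w - a)) ` cbox (-1) 1"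
  proof
    fix u assume "u \<in> {u. \<rho> ((1 / \<delta>) *\<^sub>R u + a) \<noteq> 0}"
    then have "(1 / \<delta>) *\<^sub>R u + a \<in> cbox (-1) 1" using bump_kernels_eq_0[OF \<rho>] by blast
    then show "u \<in> (\<lambda>w. \<delta> *\<^sub>R (w - a)) ` cbox (-1) 1"
      using \<open>0 < \<delta>\<close> by (intro image_eqI[of _ _ "(1 / \<delta>) *\<^sub>R u + a"]) auto
  qed
  moreover have "compact ((\<lambda>w. \<delta> *\<^sub>R (w - a)) ` cbox (-1) 1)"
    by (intro compact_continuous_image continuous_intros compact_cbox)
  ultimately show "compact (closure {u. \<rho> ((1 / \<delta>) *\<^sub>R u + a) \<noteq> 0})"
    by (meson bounded_subset compact_closure compact_imp_bounded)
qed

text \<open>The rescaled and shifted kernel is itself a nonnegative test function, and testing with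
  it reproduces the Hessian of the mollification. The substitution
  \<open>u = \<delta> *\<^sub>R y\<close> puts \<open>\<delta> ^ CARD('n)\<close> on both sides; the
  two derivatives of the test function leave \<open>\<delta>\<^sup>2\<close>.\<close>

lemma hess_ge_distr_mollify:
  fixes g \<rho> :: "real^'n \<Rightarrow> real"
  assumes g: "continuous_on UNIV g" and \<rho>: "\<rho> \<in> bump_kernels" "\<And>z. 0 \<le> \<rho> z" "(\<integral>z. \<rho> z \<partial>lborel) = 1"
    and \<delta>: "0 < \<delta>" and K: "hess_ge_distr g K"
  shows "- K * \<delta>\<^sup>2 * (\<xi> \<bullet> \<xi>) \<le> \<xi> \<bullet> (hess (mollify \<rho> (\<lambda>y. g (\<delta> *\<^sub>R y))) x *v \<xi>)"
proof -
  define f where "f y = g (\<delta> *\<^sub>R y)" for y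
  have f: "continuous_on UNIV f"
    unfolding f_def by (intro continuous_on_compose2[OF g] continuous_intros) auto
  define \<eta> where "\<eta> u = \<rho> ((1 / \<delta>) *\<^sub>R u + (- x))" for u
  have \<rho>2: "Ck 2 \<rho>" by (rule Ck_bump_kernels[OF \<rho>(1)])
  define q where "q y = \<xi> \<bullet> (hess \<rho> y *v \<xi>)" for y
  have q_eq: "q y = (\<Sum>i\<in>UNIV. \<Sum>j\<in>UNIV. \<xi> $ i * \<xi> $ j * partial j (partial i \<rho>) y)" for y
    by (simp add: q_def hess_def inner_vec_def matrix_vector_mult_def sum_distrib_left mult_ac)
  have \<rho>ij: "partial j (partial i \<rho>) \<in> bump_kernels" for i j
    by (intro bump_kernels_partial \<rho>)
  have cont_k: "continuous_on UNIV (\<lambda>u. k ((1 / \<delta>) *\<^sub>R u + (- x)))" if "k \<in> bump_kernels" for k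
    by (intro continuous_on_compose2[OF bump_kernels_continuous[OF that, of UNIV]] continuous_intros) auto
  have "(\<integral>u. g u * (\<xi> \<bullet> (hess \<eta> u *v \<xi>)) \<partial>lborel) \<ge> - K * (\<xi> \<bullet> \<xi>) * (\<integral>u. \<eta> u \<partial>lborel)"
    using K test_function_kernel[OF \<rho>(1) \<delta>, of "- x"] \<rho>(2) by (simp add: hess_ge_distr_def \<eta>_def[abs_def])
  moreover have "(\<integral>u. \<eta> u \<partial>lborel) = \<delta> ^ CARD('n)"
  proof -
    have "(\<integral>u. \<eta> u \<partial>lborel) = \<delta> ^ CARD('n) * (\<integral>y. \<rho> (y - x) \<partial>lborel)"
      using \<delta> cont_k[OF \<rho>(1)]
      by (subst lborel_integral_scale[OF _ \<delta>]) (auto simp: \<eta>_def[abs_def] intro!: borel_measurable_continuous_onI)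
    also have "(\<integral>y. \<rho> (y - x) \<partial>lborel) = 1"
      using mollify_eq_shift[of "\<lambda>_. 1", OF _ \<rho>(1), of x] \<rho>(3) by (simp add: mollify_def)
    finally show ?thesis by simp
  qed
  moreover have "(\<integral>u. g u * (\<xi> \<bullet> (hess \<eta> u *v \<xi>)) \<partial>lborel)
      = \<delta> ^ CARD('n) * (1 / \<delta>)\<^sup>2 * (\<xi> \<bullet> (hess (mollify \<rho> f) x *v \<xi>))"
  proof -
    have "\<xi> \<bullet> (hess \<eta> u *v \<xi>) = (1 / \<delta>)\<^sup>2 * q ((1 / \<delta>) *\<^sub>R u + (- x))" for u
      unfolding \<eta>_def hess_affine[OF \<rho>2] q_def by (simp add: scaleR_matrix_vector_assoc[symmetric])
    then have "(\<integral>u. g u * (\<xi> \<bullet> (hess \<eta> u *v \<xi>)) \<partial>lborel)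
        = (\<integral>u. g u * ((1 / \<delta>)\<^sup>2 * q ((1 / \<delta>) *\<^sub>R u + (- x))) \<partial>lborel)"
      by simp
    also have "\<dots> = \<delta> ^ CARD('n) * (\<integral>y. f y * ((1 / \<delta>)\<^sup>2 * q (y - x)) \<partial>lborel)"
    proof (subst lborel_integral_scale[OF _ \<delta>])
      show "(\<lambda>u. g u * ((1 / \<delta>)\<^sup>2 * q ((1 / \<delta>) *\<^sub>R u + - x))) \<in> borel_measurable borel"
        unfolding q_eq by (intro borel_measurable_continuous_onI continuous_intros g cont_k \<rho>ij)
    qed (use \<delta> in \<open>simp add: f_def\<close>)
    also have "(\<integral>y. f y * ((1 / \<delta>)\<^sup>2 * q (y - x)) \<partial>lborel) = (1 / \<delta>)\<^sup>2 * (\<integral>y. f y * q (y - x) \<partial>lborel)"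
      by (subst integral_mult_right_zero[symmetric]) (simp add: mult_ac)
    also have "(\<integral>y. f y * q (y - x) \<partial>lborel) = (\<integral>y. (\<Sum>i\<in>UNIV. \<Sum>j\<in>UNIV.
        \<xi> $ i * \<xi> $ j * (f y * partial j (partial i \<rho>) (y - x))) \<partial>lborel)"
      by (simp add: q_eq sum_distrib_left mult_ac)
    also have "\<dots> = (\<Sum>i\<in>UNIV. \<Sum>j\<in>UNIV. \<xi> $ i * \<xi> $ j * mollify (partial j (partial i \<rho>)) f x)"
      by (simp add: integrable_mollify[OF f \<rho>ij] mollify_def)
    also have "\<dots> = \<xi> \<bullet> (hess (mollify \<rho> f) x *v \<xi>)"
      by (simp add: hess_mollify[OF f \<rho>(1)] inner_vec_def matrix_vector_mult_def sum_distrib_left mult_ac)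
    finally show ?thesis by simp
  qed
  ultimately have "\<delta> ^ CARD('n) * (- K * (\<xi> \<bullet> \<xi>))
      \<le> \<delta> ^ CARD('n) * ((1 / \<delta>)\<^sup>2 * (\<xi> \<bullet> (hess (mollify \<rho> f) x *v \<xi>)))"
    by (simp add: mult_ac)
  then have "- K * (\<xi> \<bullet> \<xi>) \<le> (1 / \<delta>)\<^sup>2 * (\<xi> \<bullet> (hess (mollify \<rho> f) x *v \<xi>))"
    using \<delta> by (simp only: mult_le_cancel_left_pos zero_less_power)
  then show ?thesis
    using \<delta> by (simp add: f_def[abs_def] field_simps)
qed

text \<open>\<open>c\<close> precedes \<open>g\<close>, \<mu>, \<open>L\<close> and \<delta>: it
  depends only on the dimension and on the chosen kernel. The sup and Hoelder bounds of \<phi> are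
  those of \<open>g\<close> with no loss, so one radius \<open>R\<close> in the regularity
  conditions serves all scales.\<close>

lemma smooth_approximation:
  obtains c :: real where "0 \<le> c"
    "\<And>(g :: real^'n \<Rightarrow> real) \<mu> L B \<delta>. \<lbrakk>0 < \<mu>; \<mu> \<le> 1; 0 \<le> L; \<And>x. \<bar>g x\<bar> \<le> B;
        \<And>x y. \<bar>g x - g y\<bar> \<le> L * norm (x - y) powr \<mu>; 0 < \<delta>\<rbrakk> \<Longrightarrow>
      \<exists>\<phi>. Ck 2 \<phi> \<and> (\<forall>x. sym_mat (hess \<phi> x)) \<and> (\<forall>x. \<bar>\<phi> x\<bar> \<le> B) \<and>
        (\<forall>x y. \<bar>\<phi> x - \<phi> y\<bar> \<le> L * norm (x - y) powr \<mu>) \<and>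
        (\<forall>x. \<bar>\<phi> x - g x\<bar> \<le> c * L * \<delta> powr \<mu>) \<and>
        (\<forall>x. norm (grad \<phi> x) \<le> c * L * \<delta> powr \<mu> / \<delta>) \<and>
        (\<forall>x. norm (hess \<phi> x) \<le> c * L * \<delta> powr \<mu> / \<delta>\<^sup>2) \<and>
        (\<forall>K. hess_ge_distr g K \<longrightarrow> (\<forall>x. psd (hess \<phi> x + K *\<^sub>R mat 1)))"
proof -
  obtain \<rho> :: "real^'n \<Rightarrow> real" where \<rho>: "\<rho> \<in> bump_kernels" "\<And>z. 0 \<le> \<rho> z" "(\<integral>z. \<rho> z \<partial>lborel) = 1"
    using standard_mollifier by blast
  define n where "n = real CARD('n)"
  have n: "1 \<le> n" by (simp add: n_def Suc_le_eq)
  define I where "I k = (\<integral>z. \<bar>k z\<bar> \<partial>lborel)" for k :: "real^'n \<Rightarrow> real"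
  have I_nonneg: "0 \<le> I k" for k by (simp add: I_def)
  have I_\<rho>: "I \<rho> = 1" using \<rho> by (simp add: I_def)
  define c1 where "c1 = (\<Sum>i\<in>UNIV. I (partial i \<rho>))"
  define c2 where "c2 = (\<Sum>i\<in>UNIV. \<Sum>j\<in>UNIV. I (partial j (partial i \<rho>)))"
  have c12: "0 \<le> c1" "0 \<le> c2" by (auto simp: c1_def c2_def intro!: sum_nonneg I_nonneg)
  \<comment> \<open>\<open>n\<close> bounds the oscillation over the unit cube, where
    \<open>norm z \<le> n\<close> and \<open>n powr \<mu> \<le> n\<close>; the summands serve the
    distance to \<open>g\<close>, the gradient and the Hessian.\<close>
  define c where "c = n * (1 + c1 + c2)"
  show ?thesis
  proof (rule that[of c], goal_cases)
    case 1
    show ?case using c12 n by (simp add: c_def)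
  next
    case (2 g \<mu> L B \<delta>)
    note \<mu> = 2(1,2) and L = 2(3) and B = 2(4) and g = 2(5) and \<delta> = 2(6)
    have g_cont: "continuous_on UNIV g" by (rule holder_imp_continuous[OF \<mu>(1) g])
    define f where "f y = g (\<delta> *\<^sub>R y)" for y
    have f: "continuous_on UNIV f"
      unfolding f_def by (intro continuous_on_compose2[OF g_cont] continuous_intros) auto
    have f_shift: "continuous_on UNIV (\<lambda>z. f (x + z))" for x
      by (intro continuous_on_compose2[OF f] continuous_intros) auto
    define \<omega> where "\<omega> = n * L * \<delta> powr \<mu>"
    have \<omega>_nonneg: "0 \<le> \<omega>" using n L by (simp add: \<omega>_def)
    have f_osc: "\<bar>f (x + z) - f x\<bar> \<le> \<omega>" if "z \<in> cbox (-1) 1" for x z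
    proof -
      have "norm z \<le> (\<Sum>i\<in>UNIV. norm (z $ i))" by (rule norm_le_sum_norm_nth)
      also have "\<dots> \<le> (\<Sum>i\<in>(UNIV::'n set). 1)"
        using that by (intro sum_mono) (auto simp: mem_box_cart abs_le_iff minus_le_iff)
      finally have z: "norm z \<le> n" by (simp add: n_def)
      have "\<bar>f (x + z) - f x\<bar> \<le> L * (\<delta> * norm z) powr \<mu>"
        using g[of "\<delta> *\<^sub>R (x + z)" "\<delta> *\<^sub>R x"] \<delta> by (simp add: f_def scaleR_right_distrib)
      also have "\<dots> \<le> L * (\<delta> * n) powr \<mu>"
        using z \<delta> \<mu> L by (intro mult_left_mono powr_mono2) auto
      also have "\<dots> = L * (\<delta> powr \<mu> * n powr \<mu>)"
        using \<delta> n by (simp add: powr_mult)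
      also have "\<dots> \<le> L * (\<delta> powr \<mu> * n)"
        using powr_mono[of \<mu> 1 n] \<mu> n L by (intro mult_left_mono) auto
      finally show ?thesis by (simp add: \<omega>_def mult_ac)
    qed
    have bound: "\<bar>mollify (partial i k) f y\<bar> \<le> \<omega> * I (partial i k)" if "k \<in> bump_kernels" for i k y
      unfolding I_def by (rule mollify_partial_bound[OF f that], rule f_osc)
    define G where "G = mollify \<rho> f"
    define \<phi> where "\<phi> x = G ((1 / \<delta>) *\<^sub>R x + 0)" for x
    have G2: "Ck 2 G" unfolding G_def by (rule Ck_mollify[OF f \<rho>(1)])
    have \<phi>2: "Ck 2 \<phi>" unfolding \<phi>_def using Ck_affine[OF G2, of 1 "1 / \<delta>" 0] by simp
    have grad: "grad \<phi> x = (1 / \<delta>) *\<^sub>R grad G ((1 / \<delta>) *\<^sub>R x + 0)" for x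
      unfolding \<phi>_def by (rule grad_affine[OF G2])
    have hess: "hess \<phi> x = (1 / \<delta>)\<^sup>2 *\<^sub>R hess G ((1 / \<delta>) *\<^sub>R x + 0)" for x
      unfolding \<phi>_def by (rule hess_affine[OF G2])
    have G_shift: "G y = (\<integral>z. f (y + z) * \<rho> z \<partial>lborel)" for y
      unfolding G_def by (rule mollify_eq_shift[OF f \<rho>(1)])
    have int_\<rho>: "\<bar>\<integral>z. h z * \<rho> z \<partial>lborel\<bar> \<le> w"
      if "continuous_on UNIV h" "\<And>z. z \<in> cbox (-1) 1 \<Longrightarrow> \<bar>h z\<bar> \<le> w" for h w
      using integral_mult_kernel_bound[OF that(1) \<rho>(1) that(2)] I_\<rho> by (simp add: I_def)
    have intble: "integrable lborel (\<lambda>z. f (y + z) * \<rho> z)" for y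
      by (rule integrable_mult_kernel[OF f_shift \<rho>(1)])
    show ?case
    proof (intro exI[of _ \<phi>] conjI allI impI)
      show "Ck 2 \<phi>" by (rule \<phi>2)
      show sym: "sym_mat (hess \<phi> x)" for x
        unfolding hess G_def by (intro sym_mat_scaleR sym_mat_hess_mollify f \<rho>)
      \<comment> \<open>This bound and the next are inherited because \<phi> is an average of
        translates of \<open>g\<close> with nonnegative weights of total mass 1.\<close>
      show "\<bar>\<phi> x\<bar> \<le> B" for x
        unfolding \<phi>_def G_shift using B by (intro int_\<rho> f_shift) (simp add: f_def)
      show "\<bar>\<phi> x - \<phi> y\<bar> \<le> L * norm (x - y) powr \<mu>" for x y
      proof -
        have "\<phi> x - \<phi> y = (\<integral>z. (f ((1 / \<delta>) *\<^sub>R x + 0 + z) - f ((1 / \<delta>) *\<^sub>R y + 0 + z)) * \<rho> z \<partial>lborel)"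
          unfolding \<phi>_def G_shift by (simp add: left_diff_distrib intble[simplified] flip: Bochner_Integration.integral_diff)
        moreover have "\<bar>f ((1 / \<delta>) *\<^sub>R x + 0 + z) - f ((1 / \<delta>) *\<^sub>R y + 0 + z)\<bar> \<le> L * norm (x - y) powr \<mu>" for z
          using g[of "\<delta> *\<^sub>R ((1 / \<delta>) *\<^sub>R x + 0 + z)" "\<delta> *\<^sub>R ((1 / \<delta>) *\<^sub>R y + 0 + z)"] \<delta>
          by (simp add: f_def scaleR_right_distrib)
        ultimately show ?thesis
          using int_\<rho>[OF continuous_on_diff[OF f_shift f_shift]] by simp
      qed
      show "\<bar>\<phi> x - g x\<bar> \<le> c * L * \<delta> powr \<mu>" for x
      proof -
        have "\<phi> x - g x = (\<integral>z. f ((1 / \<delta>) *\<^sub>R x + z) * \<rho> z - f ((1 / \<delta>) *\<^sub>R x) * \<rho> z \<partial>lborel)"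
          using intble integrable_kernel[OF \<rho>(1)] \<delta> by (simp add: \<phi>_def G_shift \<rho>(3) f_def)
        also have "\<dots> = (\<integral>z. (f ((1 / \<delta>) *\<^sub>R x + z) - f ((1 / \<delta>) *\<^sub>R x)) * \<rho> z \<partial>lborel)"
          by (simp add: left_diff_distrib)
        finally have "\<bar>\<phi> x - g x\<bar> \<le> \<omega>"
          using int_\<rho>[OF continuous_on_diff[OF f_shift continuous_on_const] f_osc] by simp
        also have "\<omega> \<le> \<omega> * (1 + c1 + c2)" using \<omega>_nonneg c12 by (simp add: mult_le_cancel_left1)
        finally show ?thesis by (simp add: \<omega>_def c_def mult_ac)
      qed
      show "norm (grad \<phi> x) \<le> c * L * \<delta> powr \<mu> / \<delta>" for x
      proof -
        have "norm (grad G y) \<le> c * L * \<delta> powr \<mu>" for y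
        proof -
          have "norm (grad G y) \<le> (\<Sum>i\<in>UNIV. norm (grad G y $ i))" by (rule norm_le_sum_norm_nth)
          also have "\<dots> \<le> (\<Sum>i\<in>UNIV. \<omega> * I (partial i \<rho>))"
            unfolding G_def grad_def partial_mollify[OF f \<rho>(1)]
            using bound[OF \<rho>(1)] by (intro sum_mono) simp
          also have "\<dots> = \<omega> * c1" by (simp add: c1_def sum_distrib_left)
          also have "\<dots> \<le> \<omega> * (1 + c1 + c2)" using \<omega>_nonneg c12 by (intro mult_left_mono) auto
          finally show ?thesis by (simp add: \<omega>_def c_def mult_ac)
        qed
        then show ?thesis unfolding grad using \<delta> by (simp add: divide_right_mono)
      qed
      show "norm (hess \<phi> x) \<le> c * L * \<delta> powr \<mu> / \<delta>\<^sup>2" for x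
      proof -
        have "norm (hess G y) \<le> c * L * \<delta> powr \<mu>" for y
        proof -
          have "norm (hess G y) \<le> (\<Sum>i\<in>UNIV. norm (hess G y $ i))" by (rule norm_le_sum_norm_nth)
          also have "\<dots> \<le> (\<Sum>i\<in>UNIV. \<Sum>j\<in>UNIV. norm (hess G y $ i $ j))"
            by (intro sum_mono norm_le_sum_norm_nth)
          also have "\<dots> \<le> (\<Sum>i\<in>UNIV. \<Sum>j\<in>UNIV. \<omega> * I (partial j (partial i \<rho>)))"
            unfolding G_def hess_mollify[OF f \<rho>(1)]
            using bound[OF bump_kernels_partial[OF \<rho>(1)]] by (intro sum_mono) simp
          also have "\<dots> = \<omega> * c2" by (simp add: c2_def sum_distrib_left)
          also have "\<dots> \<le> \<omega> * (1 + c1 + c2)" using \<omega>_nonneg c12 by (intro mult_left_mono) auto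
          finally show ?thesis by (simp add: \<omega>_def c_def mult_ac)
        qed
        then show ?thesis unfolding hess using \<delta> by (simp add: divide_right_mono power_divide)
      qed
      \<comment> \<open>The \<open>\<delta>\<^sup>2\<close> in the bound at unit scale cancels
        against the rescaling of the Hessian, so \<open>K\<close> survives unchanged.\<close>
      show "psd (hess \<phi> x + K *\<^sub>R mat 1)" if "hess_ge_distr g K" for K x
      proof -
        have "0 \<le> \<xi> \<bullet> ((hess \<phi> x + K *\<^sub>R mat 1) *v \<xi>)" for \<xi>
          using hess_ge_distr_mollify[OF g_cont \<rho> \<delta> that, of \<xi> "(1 / \<delta>) *\<^sub>R x + 0"] \<delta>
          by (simp add: hess G_def f_def[abs_def] matrix_vector_mult_add_rdistrib
              scaleR_matrix_vector_assoc[symmetric] inner_add_right field_simps)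
        moreover have "sym_mat (hess \<phi> x + K *\<^sub>R mat 1)"
          using sym psd_mat_1 by (intro sym_mat_add sym_mat_scaleR) (auto simp: psd_def)
        ultimately show ?thesis by (simp add: psd_def)
      qed
    qed
  qed
qed

section \<open>The error estimates\<close>

lemma proper_mono: "proper F \<Longrightarrow> sym_mat X \<Longrightarrow> r \<le> s \<Longrightarrow> F x r p X \<le> F x s p X"
  using psd_0 unfolding proper_def by (metis diff_self)

lemma proper_obstacle_op: "proper F \<Longrightarrow> proper (obstacle_op F g)"
  unfolding proper_def obstacle_op_def by (intro allI impI min.mono) auto

lemma proper_penalized_op:
  assumes "proper F" "0 < \<epsilon>" shows "proper (penalized_op F g \<epsilon>)"
  unfolding proper_def penalized_op_def
proof (intro allI impI diff_mono mult_left_mono)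
  show "neg_part (s - g x) \<le> neg_part (r - g x)" if "sym_mat X \<and> sym_mat Y \<and> psd (X - Y) \<and> r \<le> s"
    for x r s and X Y :: "real^'n^'n"
    using that by (auto simp: neg_part_def)
qed (use assms in \<open>auto simp: proper_def\<close>)

lemma penalization_error:
  fixes F :: "'n::finite operator" and g u v \<phi> :: "real^'n \<Rightarrow> real"
  assumes "weak_solution_notion subsol supersol adm" and \<epsilon>: "0 < \<epsilon>"
    and cmp: "comparison_assm subsol supersol adm F g \<epsilon>" and F: "proper F"
    and u: "weak_solution subsol supersol adm (obstacle_op F g) u"
    and v: "weak_solution subsol supersol adm (penalized_op F g \<epsilon>) v"
    and \<phi>: "Ck 2 \<phi>" "\<And>x. sym_mat (hess \<phi> x)" "\<And>x. \<bar>\<phi> x\<bar> \<le> B" "\<And>x. \<bar>\<phi> x - g x\<bar> \<le> \<eta>"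
    and M: "\<And>x. F x (\<phi> x) (grad \<phi> x) (hess \<phi> x) \<le> M" "0 \<le> M"
  shows "0 \<le> u x - v x \<and> u x - v x \<le> 2 * \<eta> + \<epsilon> * M"
proof -
  interpret weak_solution_notion subsol supersol adm by fact
  note po = proper_obstacle_op[OF F, of g] and pp = proper_penalized_op[OF F \<epsilon>, of g]
  have cmp_o: "w1 x \<le> w2 x"
    if "w1 \<in> adm" "w2 \<in> adm" "subsol (obstacle_op F g) w1" "supersol (obstacle_op F g) w2" for w1 w2 x
    using cmp that by (auto simp: comparison_assm_def comparison_def)
  have cmp_p: "w1 x \<le> w2 x"
    if "w1 \<in> adm" "w2 \<in> adm" "subsol (penalized_op F g \<epsilon>) w1" "supersol (penalized_op F g \<epsilon>) w2" for w1 w2 x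
    using cmp that by (auto simp: comparison_assm_def comparison_def)
  have u': "u \<in> adm" "subsol (obstacle_op F g) u" "supersol (obstacle_op F g) u"
    using u by (auto simp: weak_solution_def)
  have v': "v \<in> adm" "subsol (penalized_op F g \<epsilon>) v" "supersol (penalized_op F g \<epsilon>) v"
    using v by (auto simp: weak_solution_def)
  \<comment> \<open>A nonnegative minimum gives both \<open>F \<ge> 0\<close> and
    \<open>u \<ge> g\<close>, and the latter switches the penalty off. The shift by 0 serves to
    exchange the operator.\<close>
  have "supersol (penalized_op F g \<epsilon>) (\<lambda>x. u x + 0)"
    by (rule supersol_shift[OF po pp u'(3)]) (auto simp: obstacle_op_def penalized_op_def neg_part_def)
  then have vu: "v x \<le> u x" for x
    using cmp_p[OF v'(1) u'(1) v'(2)] by simp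
  have \<eta>: "0 \<le> \<eta>" using \<phi>(4) abs_ge_zero order_trans by blast
  \<comment> \<open>Lowering by \<eta> brings \<phi> below \<open>g\<close>; the further
    \<open>\<epsilon> * M\<close> makes the penalty at least \<open>M\<close>, the bound on
    \<open>F\<close>.\<close>
  define w where "w x = \<phi> x + (- (\<eta> + \<epsilon> * M))" for x
  have w: "Ck 2 w" "grad w = grad \<phi>" "hess w = hess \<phi>"
    unfolding w_def by (rule Ck_2_add_const[OF \<phi>(1)])+
  have w_bdd: "bounded (range w)"
  proof -
    have "\<bar>w x\<bar> \<le> B + \<bar>\<eta> + \<epsilon> * M\<bar>" for x
      unfolding w_def using \<phi>(3)[of x] by linarith
    then show ?thesis by (auto simp: bounded_iff)
  qed
  have "subsol (penalized_op F g \<epsilon>) w"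
  proof (rule subsol_classical[OF pp w(1) w_bdd])
    fix x
    have "0 \<le> \<epsilon> * M" using \<epsilon> M(2) by simp
    then have "w x \<le> \<phi> x" using \<eta> by (simp add: w_def)
    then have "F x (w x) (grad w x) (hess w x) \<le> F x (\<phi> x) (grad \<phi> x) (hess \<phi> x)"
      unfolding w by (rule proper_mono[OF F \<phi>(2)])
    also have "\<dots> \<le> M" by (rule M)
    also have "\<dots> \<le> 1 / \<epsilon> * neg_part (w x - g x)"
    proof -
      have "w x - g x \<le> - (\<epsilon> * M)" using \<phi>(4)[of x] by (simp add: w_def)
      then have "\<epsilon> * M \<le> neg_part (w x - g x)" by (auto simp: neg_part_def)
      then show ?thesis using \<epsilon> by (simp add: field_simps)
    qed
    finally show "penalized_op F g \<epsilon> x (w x) (grad w x) (hess w x) \<le> 0"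
      by (simp add: penalized_op_def)
  qed
  then have wv: "w x \<le> v x" for x
    using cmp_p[OF adm_C2[OF w(1) w_bdd] v'(1) _ v'(3)] by simp
  \<comment> \<open>One \<eta> comes from lowering the barrier, the other from replacing \<phi> by
    \<open>g\<close>.\<close>
  define c where "c = 2 * \<eta> + \<epsilon> * M"
  have c: "0 \<le> c" using \<eta> \<epsilon> M(2) by (simp add: c_def)
  have gv: "g x \<le> v x + c" for x
    using wv[of x] \<phi>(4)[of x] by (simp add: w_def c_def)
  have "supersol (obstacle_op F g) (\<lambda>x. v x + c)"
  proof (rule supersol_shift[OF pp po v'(3)])
    fix x p and X :: "real^'n^'n"
    assume X: "sym_mat X" and "0 \<le> penalized_op F g \<epsilon> x (v x) p X"
    moreover have "0 \<le> 1 / \<epsilon> * neg_part (v x - g x)"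
      using \<epsilon> by (intro mult_nonneg_nonneg) (auto simp: neg_part_def)
    ultimately have "0 \<le> F x (v x) p X" by (simp add: penalized_op_def)
    also have "\<dots> \<le> F x (v x + c) p X"
      using c by (intro proper_mono[OF F X]) simp
    finally show "0 \<le> obstacle_op F g x (v x + c) p X"
      using gv[of x] by (simp add: obstacle_op_def)
  qed
  then have "u x \<le> v x + c"
    using cmp_o[OF u'(1) adm_add_const[OF v'(1)] u'(2)] by blast
  then show ?thesis using vu[of x] by (simp add: c_def)
qed

section \<open>Norms as real bounds\<close>

lemma sup_norm_le: "(\<And>x. norm (f x) \<le> a) \<Longrightarrow> sup_norm f \<le> ereal a"
  unfolding sup_norm_def by (rule SUP_least) simp

text \<open>Turns the extended-real right-hand sides of the regularity conditions into real
  arithmetic.\<close>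

lemma sup_norm_bounded:
  assumes "\<And>x. norm (f x) \<le> a"
  obtains s where "sup_norm f = ereal s" "0 \<le> s" "s \<le> a"
proof -
  have "0 \<le> ereal (norm (f 0))" by simp
  also have "\<dots> \<le> sup_norm f" unfolding sup_norm_def by (rule SUP_upper) simp
  finally have "0 \<le> sup_norm f" .
  moreover have "sup_norm f \<le> ereal a" by (rule sup_norm_le[OF assms])
  ultimately show ?thesis using that by (cases "sup_norm f") auto
qed

lemma holder_seminorm_le:
  assumes "0 \<le> L" "\<And>x y. \<bar>f x - f y\<bar> \<le> L * norm (x - y) powr \<mu>"
  shows "holder_seminorm \<mu> f \<le> ereal L"
  unfolding holder_seminorm_def
proof (intro SUP_least)
  fix x y :: "real^'a" assume "y \<in> - {x}"
  then have "0 < norm (x - y) powr \<mu>" by auto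
  then show "ereal (\<bar>f x - f y\<bar> / norm (x - y) powr \<mu>) \<le> ereal L"
    using assms(2)[of x y] by (simp add: pos_divide_le_eq)
qed

lemma holder_space_bounds:
  assumes "g \<in> holder_space \<mu>"
  obtains B L where "0 \<le> L" "\<And>x. \<bar>g x\<bar> \<le> B" "\<And>x y. \<bar>g x - g y\<bar> \<le> L * norm (x - y) powr \<mu>"
proof -
  have fin: "sup_norm g \<noteq> \<infinity>" "holder_seminorm \<mu> g \<noteq> \<infinity>"
    using assms by (auto simp: holder_space_def holder_norm_def)
  obtain B where B: "sup_norm g \<le> ereal B" using fin(1) by (cases "sup_norm g") auto
  obtain L where L: "holder_seminorm \<mu> g \<le> ereal L" using fin(2) by (cases "holder_seminorm \<mu> g") auto
  show ?thesis
  proof (rule that[of "max 0 L" B])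
    show "0 \<le> max 0 L" by simp
    show "\<bar>g x\<bar> \<le> B" for x
    proof -
      have "ereal (norm (g x)) \<le> sup_norm g" unfolding sup_norm_def by (rule SUP_upper) simp
      then have "ereal (norm (g x)) \<le> ereal B" using B by (rule order_trans)
      then show ?thesis by simp
    qed
    show "\<bar>g x - g y\<bar> \<le> max 0 L * norm (x - y) powr \<mu>" for x y
    proof (cases "x = y")
      case False
      then have "ereal (\<bar>g x - g y\<bar> / norm (x - y) powr \<mu>) \<le> holder_seminorm \<mu> g"
        unfolding holder_seminorm_def by (intro SUP_upper2[where i = x] SUP_upper) auto
      then have "ereal (\<bar>g x - g y\<bar> / norm (x - y) powr \<mu>) \<le> ereal L" using L by (rule order_trans)
      then have "\<bar>g x - g y\<bar> / norm (x - y) powr \<mu> \<le> max 0 L" by simp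
      moreover have "0 < norm (x - y) powr \<mu>" using False by simp
      ultimately show ?thesis by (simp only: pos_divide_le_eq)
    qed simp
  qed
qed

lemma holder_norm_le:
  assumes "0 \<le> L" "\<And>x. \<bar>f x\<bar> \<le> B" "\<And>x y. \<bar>f x - f y\<bar> \<le> L * norm (x - y) powr \<mu>"
  shows "holder_norm \<mu> f \<le> ereal (B + L)"
  unfolding holder_norm_def plus_ereal.simps(1)[symmetric]
  by (intro add_mono sup_norm_le holder_seminorm_le) (use assms in auto)

text \<open>The scale \<open>\<delta> = \<surd>\<epsilon>\<close> balances the regularization error \<open>\<delta>\<^sup>\<mu>\<close> against the penalization error
  \<open>\<epsilon> \<delta>\<^bsup>\<mu>-2\<^esup>\<close>.\<close>

lemma penalization_rate:
  fixes g :: "real^'n \<Rightarrow> real"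
  assumes \<mu>: "0 < \<mu>" "\<mu> \<le> 1" and L: "0 \<le> L" and B: "\<And>x. \<bar>g x\<bar> \<le> B"
    and g: "\<And>x y. \<bar>g x - g y\<bar> \<le> L * norm (x - y) powr \<mu>" and A: "0 \<le> A"
    and reg: "\<And>F \<phi> a b x. reg F \<Longrightarrow> Ck 2 \<phi> \<Longrightarrow> (\<And>x. \<bar>\<phi> x\<bar> \<le> B) \<Longrightarrow>
      (\<And>x y. \<bar>\<phi> x - \<phi> y\<bar> \<le> L * norm (x - y) powr \<mu>) \<Longrightarrow> (\<And>x. norm (grad \<phi> x) \<le> a) \<Longrightarrow>
      (\<And>x. norm (mat_neg_part (hess \<phi> x)) \<le> b) \<Longrightarrow> F x (\<phi> x) (grad \<phi> x) (hess \<phi> x) \<le> A * (1 + a + b)"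
  shows "\<exists>C. \<forall>F subsol supersol adm \<epsilon> u v.
      weak_solution_notion subsol supersol adm \<and> 0 < \<epsilon> \<and> \<epsilon> \<le> \<epsilon>max \<and>
      comparison_assm subsol supersol adm F g \<epsilon> \<and> proper F \<and> reg F \<and>
      weak_solution subsol supersol adm (obstacle_op F g) u \<and>
      weak_solution subsol supersol adm (penalized_op F g \<epsilon>) v \<longrightarrow>
      (\<forall>x. 0 \<le> u x - v x \<and> u x - v x \<le> C * \<epsilon> powr (\<mu> / 2))"
proof -
  obtain c where c: "0 \<le> c" and approx:
    "\<And>\<delta>. 0 < \<delta> \<Longrightarrow> \<exists>\<phi>. Ck 2 \<phi> \<and> (\<forall>x. sym_mat (hess \<phi> x)) \<and> (\<forall>x. \<bar>\<phi> x\<bar> \<le> B) \<and>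
        (\<forall>x y. \<bar>\<phi> x - \<phi> y\<bar> \<le> L * norm (x - y) powr \<mu>) \<and>
        (\<forall>x. \<bar>\<phi> x - g x\<bar> \<le> c * L * \<delta> powr \<mu>) \<and>
        (\<forall>x. norm (grad \<phi> x) \<le> c * L * \<delta> powr \<mu> / \<delta>) \<and>
        (\<forall>x. norm (hess \<phi> x) \<le> c * L * \<delta> powr \<mu> / \<delta>\<^sup>2) \<and>
        (\<forall>K. hess_ge_distr g K \<longrightarrow> (\<forall>x. psd (hess \<phi> x + K *\<^sub>R mat 1)))"
    by (rule smooth_approximation) (use \<mu> L B g in blast)
  define D where "D = c * L"
  have D: "0 \<le> D" using c L by (simp add: D_def)
  \<comment> \<open>\<open>2 * D\<close> is the regularization error. The bracket collects the three
    terms of \<open>\<epsilon> * M\<close>, each divided by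
    \<open>A * \<epsilon> powr (\<mu> / 2)\<close> and taken at its worst value up to
    \<open>\<epsilon>max\<close>.\<close>
  define C where "C = 2 * D + A * (\<epsilon>max powr (1 - \<mu> / 2) + D * sqrt \<epsilon>max + D)"
  show ?thesis
  proof (intro exI[of _ C] allI impI, elim conjE, goal_cases)
    case (1 F subsol supersol adm \<epsilon> u v x)
    note wsn = 1(1) and \<epsilon> = 1(2,3) and cmp = 1(4) and F = 1(5) and bound = reg[OF 1(6)] and sols = 1(7,8)
    define \<delta> where "\<delta> = sqrt \<epsilon>"
    have \<delta>: "0 < \<delta>" "\<delta>\<^sup>2 = \<epsilon>" using \<epsilon> by (auto simp: \<delta>_def)
    define r where "r = \<epsilon> powr (\<mu> / 2)"
    have r: "\<delta> powr \<mu> = r" "0 \<le> r"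
      using \<epsilon> by (auto simp: \<delta>_def r_def powr_half_sqrt[symmetric] powr_powr)
    obtain \<phi> where \<phi>: "Ck 2 \<phi>" "\<And>x. sym_mat (hess \<phi> x)" "\<And>x. \<bar>\<phi> x\<bar> \<le> B"
        "\<And>x y. \<bar>\<phi> x - \<phi> y\<bar> \<le> L * norm (x - y) powr \<mu>" "\<And>x. \<bar>\<phi> x - g x\<bar> \<le> D * r"
        "\<And>x. norm (grad \<phi> x) \<le> D * r / \<delta>" "\<And>x. norm (hess \<phi> x) \<le> D * r / \<epsilon>"
      using approx[OF \<delta>(1)] unfolding r(1) \<delta>(2) D_def by blast
    define M where "M = A * (1 + D * r / \<delta> + D * r / \<epsilon>)"
    have M: "0 \<le> M" using A D r \<delta> \<epsilon> by (simp add: M_def)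
    \<comment> \<open>The negative part of the Hessian is estimated here by the norm of the full
      Hessian.\<close>
    have F_le: "F x (\<phi> x) (grad \<phi> x) (hess \<phi> x) \<le> M" for x
      unfolding M_def by (rule bound[OF \<phi>(1,3,4,6) order_trans[OF norm_mat_neg_part_le[OF \<phi>(2)] \<phi>(7)]])
    have "0 \<le> u x - v x \<and> u x - v x \<le> 2 * (D * r) + \<epsilon> * M"
      by (rule penalization_error[OF wsn \<epsilon>(1) cmp F sols \<phi>(1-3,5) F_le M])
    moreover have "\<epsilon> * M \<le> A * (\<epsilon>max powr (1 - \<mu> / 2) + D * sqrt \<epsilon>max + D) * r"
    proof -
      have "\<epsilon> = \<epsilon> powr (1 - \<mu> / 2) * r"
        using \<epsilon> by (simp add: r_def powr_add[symmetric])
      also have "\<dots> \<le> \<epsilon>max powr (1 - \<mu> / 2) * r"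
        using \<epsilon> \<mu> r by (intro mult_right_mono powr_mono2) auto
      finally have e1: "\<epsilon> \<le> \<epsilon>max powr (1 - \<mu> / 2) * r" .
      have "\<epsilon> * (D * r / \<delta>) = D * \<delta> * r"
        using \<delta> by (simp add: power2_eq_square flip: \<delta>(2))
      also have "\<dots> \<le> D * sqrt \<epsilon>max * r"
        using \<epsilon> D r by (intro mult_right_mono mult_left_mono) (auto simp: \<delta>_def)
      finally have e2: "\<epsilon> * (D * r / \<delta>) \<le> D * sqrt \<epsilon>max * r" .
      have "\<epsilon> * M = A * (\<epsilon> + \<epsilon> * (D * r / \<delta>) + D * r)"
        using \<epsilon> by (simp add: M_def field_simps)
      also have "\<dots> \<le> A * (\<epsilon>max powr (1 - \<mu> / 2) * r + D * sqrt \<epsilon>max * r + D * r)"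
        using e1 e2 A by (intro mult_left_mono add_mono order_refl)
      finally show ?thesis by (simp add: algebra_simps)
    qed
    ultimately show ?case by (simp add: C_def r_def[symmetric] algebra_simps)
  qed
qed

text \<open>The bound \<open>M\<close> is free of \<delta>, so \<delta> can tend to 0 with
  \<epsilon> fixed; only \<open>\<epsilon> * M\<close> remains, for \<epsilon> of any size.\<close>

lemma penalization_rate_semiconvex:
  fixes g :: "real^'n::finite \<Rightarrow> real"
  shows "\<exists>C. \<forall>F subsol supersol adm \<epsilon> u v.
        weak_solution_notion subsol supersol adm \<and> \<epsilon> > 0 \<and>
        comparison_assm subsol supersol adm F g \<epsilon> \<and> proper F \<and> regular_semiconvex F g CR \<and>
        weak_solution subsol supersol adm (obstacle_op F g) u \<and>
        weak_solution subsol supersol adm (penalized_op F g \<epsilon>) v \<longrightarrow>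
        (\<forall>x. 0 \<le> u x - v x \<and> u x - v x \<le> C * \<epsilon>)"
proof (cases "g \<in> holder_space 1 \<and> (\<exists>K. hess_ge_distr g K)")
  \<comment> \<open>The constant is chosen before \<open>F\<close>, so the conditions on
    \<open>g\<close> alone are split off; where they fail, no \<open>F\<close> qualifies.\<close>
  case False
  then show ?thesis by (auto simp: regular_semiconvex_def)
next
  case True
  then obtain K where K: "hess_ge_distr g K" by blast
  obtain B L where L: "0 \<le> L" and B: "\<And>x. \<bar>g x\<bar> \<le> B"
    and g: "\<And>x y. \<bar>g x - g y\<bar> \<le> L * norm (x - y) powr 1"
    using holder_space_bounds True by metis
  obtain c where c: "0 \<le> c" and approx:
    "\<And>\<delta>. 0 < \<delta> \<Longrightarrow> \<exists>\<phi>. Ck 2 \<phi> \<and> (\<forall>x. sym_mat (hess \<phi> x)) \<and> (\<forall>x. \<bar>\<phi> x\<bar> \<le> B) \<and>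
        (\<forall>x y. \<bar>\<phi> x - \<phi> y\<bar> \<le> L * norm (x - y) powr 1) \<and>
        (\<forall>x. \<bar>\<phi> x - g x\<bar> \<le> c * L * \<delta> powr 1) \<and>
        (\<forall>x. norm (grad \<phi> x) \<le> c * L * \<delta> powr 1 / \<delta>) \<and>
        (\<forall>x. norm (hess \<phi> x) \<le> c * L * \<delta> powr 1 / \<delta>\<^sup>2) \<and>
        (\<forall>K. hess_ge_distr g K \<longrightarrow> (\<forall>x. psd (hess \<phi> x + K *\<^sub>R mat 1)))"
    by (rule smooth_approximation) (use zero_less_one order_refl L B g in blast)
  \<comment> \<open>\<open>K\<close> may be negative, whereas the estimate of the negative part
    takes a nonnegative constant.\<close>
  define K' where "K' = max K 0 * norm (mat 1 :: real^'n^'n)"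
  define M where "M = max 0 (CR (B + L + K'))"
  show ?thesis
  proof (intro exI[of _ M] allI impI, elim conjE, goal_cases)
    case (1 F subsol supersol adm \<epsilon> u v x)
    note wsn = 1(1) and \<epsilon> = 1(2) and cmp = 1(3) and F = 1(4) and reg = 1(5) and sols = 1(6,7)
    have est: "0 \<le> u x - v x \<and> u x - v x \<le> 2 * (c * L * \<delta>) + \<epsilon> * M" if \<delta>: "0 < \<delta>" for \<delta>
    proof -
      obtain \<phi> where \<phi>: "Ck 2 \<phi>" "\<And>x. sym_mat (hess \<phi> x)" "\<And>x. \<bar>\<phi> x\<bar> \<le> B"
          "\<And>x. \<bar>\<phi> x - g x\<bar> \<le> c * L * \<delta>"
        and \<phi>': "\<And>x y. \<bar>\<phi> x - \<phi> y\<bar> \<le> L * norm (x - y) powr 1"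
          "\<And>x. psd (hess \<phi> x + K *\<^sub>R mat 1)"
        using approx[OF \<delta>] K powr_one[OF less_imp_le[OF \<delta>]] by metis
      have "norm (mat_neg_part (hess \<phi> x)) \<le> K'" for x
        unfolding K'_def
      proof (rule norm_mat_neg_part_le_if_ge[OF \<phi>(2)])
        have "psd ((hess \<phi> x + K *\<^sub>R mat 1) + (max K 0 - K) *\<^sub>R mat 1)"
          by (intro psd_add psd_scaleR \<phi>' psd_mat_1) simp
        then show "psd (hess \<phi> x + max K 0 *\<^sub>R mat 1)" by (simp add: algebra_simps)
      qed simp
      then have "holder_norm 1 \<phi> + sup_norm (\<lambda>y. mat_neg_part (hess \<phi> y)) \<le> ereal (B + L) + ereal K'"
        by (intro add_mono holder_norm_le sup_norm_le L \<phi> \<phi>')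
      then have "F x (\<phi> x) (grad \<phi> x) (hess \<phi> x) \<le> CR (B + L + K')" for x
        using reg \<phi>(1) by (simp add: regular_semiconvex_def)
      then have "F x (\<phi> x) (grad \<phi> x) (hess \<phi> x) \<le> M" for x
        by (simp add: M_def le_max_iff_disj)
      then show ?thesis
        by (intro penalization_error[OF wsn \<epsilon> cmp F sols \<phi>]) (auto simp: M_def)
    qed
    have "u x - v x \<le> M * \<epsilon> + e" if "0 < e" for e
    proof -
      \<comment> \<open>The summand 1 keeps the denominator positive when
        \<open>c * L = 0\<close>.\<close>
      define \<delta> where "\<delta> = e / (2 * (c * L) + 1)"
      have cL: "0 \<le> c * L" using c L by simp
      then have "2 * (c * L) * \<delta> \<le> (2 * (c * L) + 1) * \<delta>"
        using that by (intro mult_right_mono) (auto simp: \<delta>_def)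
      also have "\<dots> = e" using cL by (simp add: \<delta>_def)
      finally show ?thesis
        using est[of \<delta>] cL that by (simp add: \<delta>_def mult_ac)
    qed
    then show ?case using est[of 1] by (auto intro: field_le_epsilon)
  qed
qed

theorem theorem2p1:
  fixes g :: "real^'n::finite \<Rightarrow> real"
    and CR :: "real \<Rightarrow> real"
  shows
    "(\<exists>C. \<forall>F subsol supersol adm \<epsilon> u v.
        weak_solution_notion subsol supersol adm \<and> \<epsilon> > 0 \<and>
        comparison_assm subsol supersol adm F g \<epsilon> \<and> proper F \<and> regular_semiconvex F g CR \<and>
        weak_solution subsol supersol adm (obstacle_op F g) u \<and>
        weak_solution subsol supersol adm (penalized_op F g \<epsilon>) v \<longrightarrow>
        (\<forall>x. 0 \<le> u x - v x \<and> u x - v x \<le> C * \<epsilon>))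
   \<and> (\<forall>\<epsilon>max>0. \<exists>C. \<forall>F subsol supersol adm \<epsilon> u v.
        weak_solution_notion subsol supersol adm \<and> 0 < \<epsilon> \<and> \<epsilon> \<le> \<epsilon>max \<and>
        comparison_assm subsol supersol adm F g \<epsilon> \<and> proper F \<and> regular_lipschitz F g CR \<and>
        weak_solution subsol supersol adm (obstacle_op F g) u \<and>
        weak_solution subsol supersol adm (penalized_op F g \<epsilon>) v \<longrightarrow>
        (\<forall>x. 0 \<le> u x - v x \<and> u x - v x \<le> C * \<epsilon> powr (1 / 2)))
   \<and> (\<forall>\<mu>. \<forall>\<epsilon>max>0. \<exists>C. \<forall>F subsol supersol adm \<epsilon> u v.
        weak_solution_notion subsol supersol adm \<and> 0 < \<epsilon> \<and> \<epsilon> \<le> \<epsilon>max \<and>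
        comparison_assm subsol supersol adm F g \<epsilon> \<and> proper F \<and> regular_holder \<mu> F g CR \<and>
        weak_solution subsol supersol adm (obstacle_op F g) u \<and>
        weak_solution subsol supersol adm (penalized_op F g \<epsilon>) v \<longrightarrow>
        (\<forall>x. 0 \<le> u x - v x \<and> u x - v x \<le> C * \<epsilon> powr (\<mu> / 2)))"
proof (intro conjI allI impI, goal_cases)
  case 1
  show ?case by (rule penalization_rate_semiconvex)
next
  case (2 \<epsilon>max)
  show ?case
  proof (cases "g \<in> holder_space 1")
    case False
    then show ?thesis by (simp add: regular_lipschitz_def)
  next
    case True
    then obtain B L where L: "0 \<le> L" and B: "\<And>x. \<bar>g x\<bar> \<le> B"
      and g: "\<And>x y. \<bar>g x - g y\<bar> \<le> L * norm (x - y) powr 1"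
      using holder_space_bounds by metis
    show ?thesis
    \<comment> \<open>\<open>R = B + L\<close> bounds the Lipschitz norm of every
      mollification.\<close>
    proof (rule penalization_rate[OF zero_less_one order_refl L B g abs_ge_zero[of "CR (B + L)"]])
      fix F :: "'n operator" and \<phi> :: "real^'n \<Rightarrow> real" and a b x
      assume reg: "regular_lipschitz F g CR" and \<phi>: "Ck 2 \<phi>" "\<And>x. \<bar>\<phi> x\<bar> \<le> B"
          "\<And>x y. \<bar>\<phi> x - \<phi> y\<bar> \<le> L * norm (x - y) powr 1"
        and a: "\<And>x. norm (grad \<phi> x) \<le> a" and b: "\<And>x. norm (mat_neg_part (hess \<phi> x)) \<le> b"
      obtain s where s: "sup_norm (\<lambda>y. mat_neg_part (hess \<phi> y)) = ereal s" "0 \<le> s" "s \<le> b"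
        by (rule sup_norm_bounded[OF b])
      have "0 \<le> a" using a norm_ge_zero order_trans by blast
      have fin: "sup_norm (\<lambda>y. mat_neg_part (hess \<phi> y)) < \<infinity>" by (simp add: s(1))
      have "ereal (F x (\<phi> x) (grad \<phi> x) (hess \<phi> x))
          \<le> ereal (CR (B + L)) * (1 + sup_norm (\<lambda>y. mat_neg_part (hess \<phi> y)))"
        using reg \<phi>(1) holder_norm_le[OF L \<phi>(2,3)] fin unfolding regular_lipschitz_def by blast
      then have "F x (\<phi> x) (grad \<phi> x) (hess \<phi> x) \<le> CR (B + L) * (1 + s)"
        by (simp add: s(1) one_ereal_def)
      \<comment> \<open>The absolute value permits enlarging the other factor whatever the sign of
        \<open>CR (B + L)\<close>; adding \<open>a\<close> matches the form shared with the Hoelder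
        case.\<close>
      also have "\<dots> \<le> \<bar>CR (B + L)\<bar> * (1 + a + b)"
        using s \<open>0 \<le> a\<close> by (intro mult_mono) auto
      finally show "F x (\<phi> x) (grad \<phi> x) (hess \<phi> x) \<le> \<bar>CR (B + L)\<bar> * (1 + a + b)" .
    qed
  qed
next
  case (3 \<mu> \<epsilon>max)
  show ?case
  proof (cases "0 < \<mu> \<and> \<mu> < 1 \<and> g \<in> holder_space \<mu>")
    case False
    then show ?thesis by (auto simp: regular_holder_def)
  next
    case True
    then have \<mu>: "0 < \<mu>" "\<mu> \<le> 1" by auto
    obtain B L where L: "0 \<le> L" and B: "\<And>x. \<bar>g x\<bar> \<le> B"
      and g: "\<And>x y. \<bar>g x - g y\<bar> \<le> L * norm (x - y) powr \<mu>"
      using holder_space_bounds True by metis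
    show ?thesis
    \<comment> \<open>Here \<open>R\<close> controls only the sup norm; the gradient may grow as
      \<delta> shrinks and stays in the bound as \<open>a\<close>.\<close>
    proof (rule penalization_rate[OF \<mu> L B g abs_ge_zero[of "CR B"]])
      fix F :: "'n operator" and \<phi> :: "real^'n \<Rightarrow> real" and a b x
      assume reg: "regular_holder \<mu> F g CR" and \<phi>: "Ck 2 \<phi>" "\<And>x. \<bar>\<phi> x\<bar> \<le> B"
        and a: "\<And>x. norm (grad \<phi> x) \<le> a" and b: "\<And>x. norm (mat_neg_part (hess \<phi> x)) \<le> b"
      obtain s where s: "sup_norm (\<lambda>y. mat_neg_part (hess \<phi> y)) = ereal s" "0 \<le> s" "s \<le> b"
        by (rule sup_norm_bounded[OF b])
      obtain t where t: "sup_norm (grad \<phi>) = ereal t" "0 \<le> t" "t \<le> a"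
        by (rule sup_norm_bounded[OF a])
      have fin: "sup_norm (grad \<phi>) < \<infinity>" "sup_norm (\<lambda>y. mat_neg_part (hess \<phi> y)) < \<infinity>"
        by (simp_all add: s(1) t(1))
      have "sup_norm \<phi> \<le> ereal B" using \<phi>(2) by (intro sup_norm_le) simp
      then have "ereal (F x (\<phi> x) (grad \<phi> x) (hess \<phi> x)) \<le> ereal (CR B)
          * (1 + sup_norm (grad \<phi>) + sup_norm (\<lambda>y. mat_neg_part (hess \<phi> y)))"
        using reg \<phi>(1) fin unfolding regular_holder_def by blast
      then have "F x (\<phi> x) (grad \<phi> x) (hess \<phi> x) \<le> CR B * (1 + t + s)"
        by (simp add: s(1) t(1) one_ereal_def)
      also have "\<dots> \<le> \<bar>CR B\<bar> * (1 + a + b)"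
        using s t by (intro mult_mono) auto
      finally show "F x (\<phi> x) (grad \<phi> x) (hess \<phi> x) \<le> \<bar>CR B\<bar> * (1 + a + b)" .
    qed
  qed
qed

end
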